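(* The block-idempotents of $\mathcal{R}_K(q)\bar{\mathcal{H}}$ coincide with the block-idempotents of $\mathcal{R}_K(q)\mathcal{H}$.
   Context: Let $p,d\geq 1$ be integers ($p$ need not be prime), $\zeta_n:=\exp(2\pi i/n)$, $K:=\mathbb{Q}(\zeta_{2pd})$ with ring of integers $\mathbb{Z}_K$, $q$ an indeterminate, and $\mathcal{R}_K(q):=\mathbb{Z}_K[q,q^{-1},(q^n-1)^{-1}_{n\geq 1}]\subset K(q)$ the Rouquier ring. Fix integers $a_0,a_1,b_0,b_1,c_0,\ldots,c_{d-1}$ and put $e_k:=c_{k\bmod d}$ for $0\le k<pd$. $\mathcal{H}$ is the $\mathbb{Z}_K[q,q^{-1}]$-algebra (a cyclotomic Hecke algebra of $G(2pd,2,2)$) generated by $s,t,u$ with relations $stu=tus=ust$, $(s-q^{pa_0})(s+q^{pa_1})=0$, $(t-q^{pb_0})(t+q^{pb_1})=0$, $\prod_{k=0}^{pd-1}(u-\zeta_{pd}^kq^{e_k})=0$. It is free of rank $(2pd)^2=|G(2pd,2,2)|$. $\bar{\mathcal{H}}$ is the subalgebra of $\mathcal{H}$ generated by $s,t,u^p$; it is isomorphic to a cyclotomic Hecke algebra of $G(2pd,2p,2)$, free of rank $(2pd)^2/p$. The standing assumptions that these Hecke algebras are free of the stated rank and carry their canonical symmetrizing forms are in force. The block-idempotents of an algebra are the primitive idempotents of its center. *)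

theory Defs
  imports
    "HOL-Library.Poly_Mapping"
    "HOL-Algebra.Algebraic_Closure_Type"
    "HOL-Algebra.Generated_Fields"
    "HOL-Algebra.Module"
    Complex_Main
begin

section \<open>Coefficient rings\<close>

text \<open>
  All coefficient rings are subrings of the field \<open>\<complex>(q)\<close>, represented by the type
  \<^typ>\<open>complex poly fract\<close>.
\<close>

definition zeta :: "nat \<Rightarrow> complex" where
  "zeta n = exp (2 * of_real pi * \<i> / of_nat n)"

definition cyclotomic_field :: "nat \<Rightarrow> complex set" where
  "cyclotomic_field n = generate_field ring_of_type_algebra {zeta n}"

definition cyclotomic_integers :: "nat \<Rightarrow> complex set" where
  "cyclotomic_integers n = {x \<in> cyclotomic_field n. algebraic_int x}"

definition const :: "complex \<Rightarrow> complex poly fract" where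
  "const x = Fract [:x:] 1"

definition q :: "complex poly fract" where
  "q = Fract [:0, 1:] 1"

definition laurent_ring :: "nat \<Rightarrow> complex poly fract set" where
  "laurent_ring n =
     generate_ring ring_of_type_algebra (const ` cyclotomic_integers n \<union> {q, inverse q})"

definition rouquier_ring :: "nat \<Rightarrow> complex poly fract set" where
  "rouquier_ring n =
     generate_ring ring_of_type_algebra
       (const ` cyclotomic_integers n \<union> {q, inverse q} \<union> {inverse (q ^ i - 1) | i. i \<ge> 1})"


section \<open>Algebras given by generators and relations\<close>

text \<open>
  The free monoid on \<open>'x\<close>, written additively, so that the convolution product of
  \<^theory>\<open>HOL-Library.Poly_Mapping\<close> makes \<open>'x word \<Rightarrow>\<^sub>0 'k\<close> the free (noncommutative)
  algebra over \<open>'k\<close>.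
\<close>

datatype 'x word = Word (letters: "'x list")

instantiation word :: (type) monoid_add
begin

definition zero_word :: "'a word" where
  "0 = Word []"

definition plus_word :: "'a word \<Rightarrow> 'a word \<Rightarrow> 'a word" where
  "v + w = Word (letters v @ letters w)"

instance
  by standard (simp_all add: zero_word_def plus_word_def)

end

definition scalar :: "'k \<Rightarrow> 'x word \<Rightarrow>\<^sub>0 'k::field" where
  "scalar c = Poly_Mapping.single 0 c"

definition letter :: "'x \<Rightarrow> 'x word \<Rightarrow>\<^sub>0 'k::field" where
  "letter x = Poly_Mapping.single (Word [x]) 1"

definition free_algebra :: "'k::field set \<Rightarrow> ('x word \<Rightarrow>\<^sub>0 'k) ring" where
  "free_algebra C =
     ring_of_type_algebra \<lparr>carrier := {f. \<forall>w. Poly_Mapping.lookup f w \<in> C}\<rparr>"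

definition presented_algebra ::
    "'k::field set \<Rightarrow> ('x word \<Rightarrow>\<^sub>0 'k) set \<Rightarrow> ('k, ('x word \<Rightarrow>\<^sub>0 'k) set) module" where
  "presented_algebra C rels =
     (let F = free_algebra C; I = Idl\<^bsub>F\<^esub> rels in
      ring.extend (F Quot I)
        (module.fields (\<lambda>c x. (I +>\<^bsub>F\<^esub> scalar c) \<otimes>\<^bsub>F Quot I\<^esub> x)))"

definition presented_gen :: "'k::field set \<Rightarrow> ('x word \<Rightarrow>\<^sub>0 'k) set \<Rightarrow> 'x \<Rightarrow> ('x word \<Rightarrow>\<^sub>0 'k) set" where
  "presented_gen C rels x = (Idl\<^bsub>free_algebra C\<^esub> rels) +>\<^bsub>free_algebra C\<^esub> letter x"

definition generated_subalgebra :: "'k set \<Rightarrow> ('k, 'b) module \<Rightarrow> 'b set \<Rightarrow> ('k, 'b) module" where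
  "generated_subalgebra C M Y =
     M \<lparr>carrier := generate_ring M ({c \<odot>\<^bsub>M\<^esub> \<one>\<^bsub>M\<^esub> | c. c \<in> C} \<union> Y)\<rparr>"

definition free_of_rank :: "'k set \<Rightarrow> ('k, 'b) module \<Rightarrow> nat \<Rightarrow> bool" where
  "free_of_rank C M r \<longleftrightarrow>
     (\<exists>B. finite B \<and> card B = r \<and> B \<subseteq> carrier M \<and>
        (\<forall>x \<in> carrier M. \<exists>!f. f \<in> B \<rightarrow>\<^sub>E C \<and> x = (\<Oplus>\<^bsub>M\<^esub>b\<in>B. f b \<odot>\<^bsub>M\<^esub> b)))"


section \<open>The cyclotomic Hecke algebras\<close>

datatype gen = s_gen | t_gen | u_gen

definition hecke_relators ::
    "nat \<Rightarrow> nat \<Rightarrow> int \<Rightarrow> int \<Rightarrow> int \<Rightarrow> int \<Rightarrow> (nat \<Rightarrow> int) \<Rightarrow> (gen word \<Rightarrow>\<^sub>0 complex poly fract) set" where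
  "hecke_relators p d a0 a1 b0 b1 c =
     (let s = letter s_gen; t = letter t_gen; u = letter u_gen in
      {s * t * u - t * u * s,
       t * u * s - u * s * t,
       (s - scalar (q powi (int p * a0))) * (s + scalar (q powi (int p * a1))),
       (t - scalar (q powi (int p * b0))) * (t + scalar (q powi (int p * b1))),
       prod_list (map (\<lambda>k. u - scalar (const (zeta (p * d) ^ k) * q powi c (k mod d))) [0..<p * d])})"

text \<open>
  The Hecke algebra over a coefficient ring \<open>C\<close> with \<open>\<int>\<^sub>K[q,q\<^sup>-\<^sup>1] \<subseteq> C \<subseteq> \<complex>(q)\<close>.  For
  \<open>C = laurent_ring (2pd)\<close> this is \<open>\<H>\<close>.  Presentations commute with extension of scalars, so
  for \<open>C = rouquier_ring (2pd)\<close> it is \<open>\<R>\<^sub>K(q)\<H> = \<R>\<^sub>K(q) \<otimes> \<H>\<close>; see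
  \<open>hecke_rouquier_denominators\<close> and \<open>hecke_rouquier_kernel\<close> below.
\<close>

definition hecke ::
    "complex poly fract set \<Rightarrow> nat \<Rightarrow> nat \<Rightarrow> int \<Rightarrow> int \<Rightarrow> int \<Rightarrow> int \<Rightarrow> (nat \<Rightarrow> int) \<Rightarrow>
      (complex poly fract, (gen word \<Rightarrow>\<^sub>0 complex poly fract) set) module" where
  "hecke C p d a0 a1 b0 b1 c = presented_algebra C (hecke_relators p d a0 a1 b0 b1 c)"

definition hecke_gen ::
    "complex poly fract set \<Rightarrow> nat \<Rightarrow> nat \<Rightarrow> int \<Rightarrow> int \<Rightarrow> int \<Rightarrow> int \<Rightarrow> (nat \<Rightarrow> int) \<Rightarrow> gen \<Rightarrow>
      (gen word \<Rightarrow>\<^sub>0 complex poly fract) set" where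
  "hecke_gen C p d a0 a1 b0 b1 c = presented_gen C (hecke_relators p d a0 a1 b0 b1 c)"

text \<open>
  The subalgebra generated by \<open>s, t, u\<^sup>p\<close>.  Since \<open>\<R>\<^sub>K(q)\<close> is a localization of
  \<open>\<int>\<^sub>K[q,q\<^sup>-\<^sup>1]\<close>, hence flat, for \<open>C = rouquier_ring (2pd)\<close> this is the extension of scalars
  of the one for \<open>C = laurent_ring (2pd)\<close>.
\<close>

definition hecke_bar ::
    "complex poly fract set \<Rightarrow> nat \<Rightarrow> nat \<Rightarrow> int \<Rightarrow> int \<Rightarrow> int \<Rightarrow> int \<Rightarrow> (nat \<Rightarrow> int) \<Rightarrow>
      (complex poly fract, (gen word \<Rightarrow>\<^sub>0 complex poly fract) set) module" where
  "hecke_bar C p d a0 a1 b0 b1 c =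
     (let H = hecke C p d a0 a1 b0 b1 c; g = hecke_gen C p d a0 a1 b0 b1 c in
      generated_subalgebra C H {g s_gen, g t_gen, g u_gen [^]\<^bsub>H\<^esub> p})"


section \<open>Extension of scalars from \<open>\<int>\<^sub>K[q,q\<^sup>-\<^sup>1]\<close> to \<open>\<R>\<^sub>K(q)\<close>\<close>

text \<open>
  \<open>\<R>\<^sub>K(q)\<close> is a localization of \<open>\<int>\<^sub>K[q,q\<^sup>-\<^sup>1]\<close>, and the algebra presented over \<open>\<R>\<^sub>K(q)\<close>
  is the corresponding localization of \<open>\<H>\<close>: every element becomes the image of an element of
  \<open>\<H>\<close> after multiplication by a denominator, and the elements of \<open>\<H>\<close> mapping to zero are
  those annihilated by a denominator.
\<close>

lemma ring_of_type_ring_1: "ring (ring_of_type_algebra :: 'a::ring_1 ring)"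
proof -
  have "\<exists>y. x + y = 0" for x :: 'a
    using add.right_inverse by blast
  thus ?thesis
    unfolding ring_of_type_algebra_def using add.right_inverse
    by unfold_locales (auto simp: algebra_simps Units_def)
qed

lemma ring_of_type_a_inv [simp]:
  "a_inv (ring_of_type_algebra :: 'a::ring_1 ring) x = - x"
proof -
  interpret ring "ring_of_type_algebra :: 'a ring" by (rule ring_of_type_ring_1)
  have "- x \<in> carrier ring_of_type_algebra" "x \<in> carrier ring_of_type_algebra"
    by (simp_all add: ring_of_type_algebra_def)
  moreover have "- x \<oplus>\<^bsub>ring_of_type_algebra\<^esub> x = \<zero>\<^bsub>ring_of_type_algebra\<^esub>"
    by (simp add: ring_of_type_algebra_def)
  ultimately show ?thesis by (intro minus_equality)
qed

lemma subring_type_iff: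
  "subring C (ring_of_type_algebra :: 'a::ring_1 ring) \<longleftrightarrow>
     1 \<in> C \<and> (\<forall>x\<in>C. - x \<in> C) \<and> (\<forall>x\<in>C. \<forall>y\<in>C. x + y \<in> C \<and> x * y \<in> C)" (is "_ = ?r")
proof
  interpret ring "ring_of_type_algebra :: 'a ring" by (rule ring_of_type_ring_1)
  assume *: "subring C (ring_of_type_algebra :: 'a::ring_1 ring)"
  show ?r using subringE(3,5,6,7)[OF *]
    by (auto simp: ring_of_type_a_inv) (auto simp: ring_of_type_algebra_def)
next
  interpret ring "ring_of_type_algebra :: 'a ring" by (rule ring_of_type_ring_1)
  assume ?r
  then show "subring C (ring_of_type_algebra :: 'a::ring_1 ring)"
    by (intro subringI) (auto simp: ring_of_type_a_inv, auto simp: ring_of_type_algebra_def)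
qed

lemma subring_zero: 
  assumes "subring C (ring_of_type_algebra :: 'a::ring_1 ring)" shows "0 \<in> C"
  using assms unfolding subring_type_iff by (metis add.right_inverse)

lemma subring_sum:
  assumes "subring C (ring_of_type_algebra :: 'a::ring_1 ring)" "\<And>i. i \<in> I \<Longrightarrow> f i \<in> C"
  shows "sum f I \<in> C"
  using assms(2) subring_zero[OF assms(1)] assms(1)
  by (induction I rule: infinite_finite_induct) (auto simp: subring_type_iff)

lemma subring_Sum_any:
  assumes "subring C (ring_of_type_algebra :: 'a::ring_1 ring)" "\<And>i. f i \<in> C"
  shows "Sum_any f \<in> C"
  unfolding Sum_any.expand_set by (rule subring_sum[OF assms])

lemma free_algebra_subring:
  fixes C :: "'k::field set"
  assumes C: "subring C ring_of_type_algebra"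
  shows "subring {f :: 'x word \<Rightarrow>\<^sub>0 'k. \<forall>w. Poly_Mapping.lookup f w \<in> C} ring_of_type_algebra"
proof -
  have z: "0 \<in> C" by (rule subring_zero[OF C])
  have "Poly_Mapping.lookup (f * g) w \<in> C"
    if "\<forall>w. Poly_Mapping.lookup f w \<in> C" "\<forall>w. Poly_Mapping.lookup g w \<in> C"
    for f g :: "'x word \<Rightarrow>\<^sub>0 'k" and w
    unfolding lookup_mult
    using that z C
    by (intro subring_Sum_any[OF C]) (simp add: subring_type_iff when_def subring_Sum_any[OF C])
  then show ?thesis
    using C z unfolding subring_type_iff
    by (auto simp: lookup_add lookup_one when_def)
qed

lemma free_algebra_ring:
  assumes "subring C ring_of_type_algebra"
  shows "ring (free_algebra C)"
  unfolding free_algebra_def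
  by (rule ring.subring_is_ring[OF ring_of_type_ring_1 free_algebra_subring[OF assms]])

lemma laurent_subring: "subring (laurent_ring n) ring_of_type_algebra"
  and rouquier_subring: "subring (rouquier_ring n) ring_of_type_algebra"
  unfolding laurent_ring_def rouquier_ring_def
  by (rule ring.generate_ring_is_subring[OF ring_of_type_ring_1], simp add: ring_of_type_algebra_def)+

lemma free_algebra_simps [simp]:
  "carrier (free_algebra C) = {f. \<forall>w. Poly_Mapping.lookup f w \<in> C}"
  "x \<otimes>\<^bsub>free_algebra C\<^esub> y = x * y" "x \<oplus>\<^bsub>free_algebra C\<^esub> y = x + y"
  "\<one>\<^bsub>free_algebra C\<^esub> = 1" "\<zero>\<^bsub>free_algebra C\<^esub> = 0"
  by (simp_all add: free_algebra_def ring_of_type_algebra_def)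

lemma scalar_mult_lookup:
  "Poly_Mapping.lookup (scalar c * f) w = c * Poly_Mapping.lookup f w"
  "Poly_Mapping.lookup (f * scalar c) w = c * Poly_Mapping.lookup f w"
proof -
  have 1: "(\<Sum>l. Poly_Mapping.lookup (scalar c) l * h l) = c * h 0" for h
  proof -
    have "{l. Poly_Mapping.lookup (scalar c) l * h l \<noteq> 0} \<subseteq> {0}"
      by (auto simp: scalar_def lookup_single when_def)
    then show ?thesis
      by (subst Sum_any.expand_superset[of "{0}"]) (auto simp: scalar_def)
  qed
  show "Poly_Mapping.lookup (scalar c * f) w = c * Poly_Mapping.lookup f w"
    unfolding lookup_mult 1 by simp
  have 2: "(\<Sum>r. Poly_Mapping.lookup (scalar c) r when w = l + r) = (c when w = l)" for l
  proof -
    have "{r. (Poly_Mapping.lookup (scalar c) r when w = l + r) \<noteq> 0} \<subseteq> {0}"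
      by (auto simp: scalar_def lookup_single when_def)
    then show ?thesis
      by (subst Sum_any.expand_superset[of "{0}"]) (auto simp: scalar_def)
  qed
  show "Poly_Mapping.lookup (f * scalar c) w = c * Poly_Mapping.lookup f w"
    unfolding lookup_mult 2 by (simp add: mult_when mult.commute)
qed

lemma scalar_central: "scalar c * f = f * scalar c"
  by (rule poly_mapping_eqI) (simp add: scalar_mult_lookup)

lemma scalar_mult: "scalar (c * e) = scalar c * scalar e"
  by (rule poly_mapping_eqI) (simp add: scalar_mult_lookup, simp add: scalar_def lookup_single when_def)

lemma scalar_one [simp]: "scalar 1 = 1"
  by (simp add: scalar_def)

text \<open>\<open>A \<subseteq> R \<subseteq> Frac(A)\<close> where each element of \<open>R\<close> has a denominator invertible in \<open>R\<close>.\<close>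

definition is_localization :: "'k::field set \<Rightarrow> 'k set \<Rightarrow> bool" where
  "is_localization A R \<longleftrightarrow>
     subring A ring_of_type_algebra \<and> subring R ring_of_type_algebra \<and> A \<subseteq> R \<and>
     (\<forall>r \<in> R. \<exists>D \<in> A. D \<noteq> 0 \<and> inverse D \<in> R \<and> D * r \<in> A)"

definition denominators :: "'k::field set \<Rightarrow> 'k set \<Rightarrow> 'k set" where
  "denominators A R = {D \<in> A. D \<noteq> 0 \<and> inverse D \<in> R}"

lemma presented_algebra_simps:
  fixes C rels
  defines "F \<equiv> free_algebra C" and "I \<equiv> Idl\<^bsub>free_algebra C\<^esub> rels"
  shows "carrier (presented_algebra C rels) = a_rcosets\<^bsub>F\<^esub> I"
    "\<zero>\<^bsub>presented_algebra C rels\<^esub> = I"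
    "c \<odot>\<^bsub>presented_algebra C rels\<^esub> y = rcoset_mult F I (I +>\<^bsub>F\<^esub> scalar c) y"
  by (simp_all add: presented_algebra_def ring.defs module.defs Let_def FactRing_def F_def I_def)

lemma scalar_carrier: 
  assumes "subring C ring_of_type_algebra" "c \<in> C"
  shows "scalar c \<in> carrier (free_algebra C)"
  using assms subring_zero[OF assms(1)] by (auto simp: scalar_def lookup_single when_def)

lemma clear_denominators:
  assumes "is_localization A R" "x \<in> carrier (free_algebra R)"
  shows "\<exists>D \<in> denominators A R. scalar D * x \<in> carrier (free_algebra A)"
proof -
  have A: "subring A ring_of_type_algebra" and R: "subring R ring_of_type_algebra"
    and dd: "\<And>r. r \<in> R \<Longrightarrow> \<exists>D \<in> A. D \<noteq> 0 \<and> inverse D \<in> R \<and> D * r \<in> A"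
    using assms(1) by (auto simp: is_localization_def)
  have "\<exists>D \<in> denominators A R. \<forall>w\<in>W. D * Poly_Mapping.lookup x w \<in> A" if "finite W" for W
    using that
  proof (induction W)
    case empty
    have "1 \<in> denominators A R" using A R by (auto simp: denominators_def subring_type_iff)
    then show ?case by auto
  next
    case (insert w W)
    then obtain D where D: "D \<in> denominators A R" "\<forall>w\<in>W. D * Poly_Mapping.lookup x w \<in> A" by auto
    obtain E where E: "E \<in> A" "E \<noteq> 0" "inverse E \<in> R" "E * Poly_Mapping.lookup x w \<in> A"
      using dd assms(2) by fastforce
    have "D * E \<in> denominators A R" using A R D E by (auto simp: denominators_def subring_type_iff)
    moreover have "D * E * Poly_Mapping.lookup x v \<in> A" if "v \<in> insert w W" for v
    proof (cases "v = w")
      case True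
      have "D * (E * Poly_Mapping.lookup x w) \<in> A" using A D E by (auto simp: denominators_def subring_type_iff)
      then show ?thesis using True by (simp add: mult.assoc)
    next
      case False
      then have "E * (D * Poly_Mapping.lookup x v) \<in> A" using that A D E by (auto simp: denominators_def subring_type_iff)
      then show ?thesis by (simp add: mult_ac)
    qed
    ultimately show ?case by blast
  qed
  from this[of "Poly_Mapping.keys x"] obtain D where
    D: "D \<in> denominators A R" "\<forall>w\<in>Poly_Mapping.keys x. D * Poly_Mapping.lookup x w \<in> A" by auto
  have "D * Poly_Mapping.lookup x w \<in> A" for w
    using D(2) subring_zero[OF A] by (cases "w \<in> Poly_Mapping.keys x") (auto simp: in_keys_iff)
  then show ?thesis using D(1) by (intro bexI[of _ D]) (auto simp: scalar_mult_lookup)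
qed

lemma presented_ideal:
  assumes "subring C ring_of_type_algebra" "rels \<subseteq> carrier (free_algebra C)"
  shows "ideal (Idl\<^bsub>free_algebra C\<^esub> rels) (free_algebra C)"
  by (rule ring.genideal_ideal[OF free_algebra_ring[OF assms(1)] assms(2)])

lemma presented_denominators:
  fixes rels :: "('x word \<Rightarrow>\<^sub>0 'k::field) set"
  assumes loc: "is_localization A R" and rels: "rels \<subseteq> carrier (free_algebra A)"
    and y: "y \<in> carrier (presented_algebra R rels)"
  shows "\<exists>D \<in> denominators A R. \<exists>x \<in> carrier (free_algebra A).
           D \<odot>\<^bsub>presented_algebra R rels\<^esub> y = Idl\<^bsub>free_algebra R\<^esub> rels +>\<^bsub>free_algebra R\<^esub> x"
proof -
  let ?F = "free_algebra R :: ('x word \<Rightarrow>\<^sub>0 'k) ring" and ?I = "Idl\<^bsub>free_algebra R\<^esub> rels"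
  have R: "subring R ring_of_type_algebra" and AR: "A \<subseteq> R" using loc by (auto simp: is_localization_def)
  interpret ideal ?I ?F using rels AR by (intro presented_ideal R) auto
  obtain x where x: "x \<in> carrier ?F" "y = ?I +>\<^bsub>?F\<^esub> x"
    using y by (auto simp: presented_algebra_simps A_RCOSETS_def' simp del: free_algebra_simps)
  obtain D where D: "D \<in> denominators A R" "scalar D * x \<in> carrier (free_algebra A)"
    using clear_denominators[OF loc x(1)] by auto
  have "D \<in> R" using D AR by (auto simp: denominators_def)
  then have "D \<odot>\<^bsub>presented_algebra R rels\<^esub> y = ?I +>\<^bsub>?F\<^esub> (scalar D * x)"
    unfolding presented_algebra_simps x(2)
    using rcoset_mult_add[OF scalar_carrier[OF R] x(1)] by simp
  then show ?thesis using D by blast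
qed

lemma presented_kernel:
  fixes rels :: "('x word \<Rightarrow>\<^sub>0 'k::field) set"
  assumes loc: "is_localization A R" and rels: "rels \<subseteq> carrier (free_algebra A)"
    and x: "x \<in> carrier (free_algebra A)"
    and zero: "Idl\<^bsub>free_algebra R\<^esub> rels +>\<^bsub>free_algebra R\<^esub> x = \<zero>\<^bsub>presented_algebra R rels\<^esub>"
  shows "\<exists>D \<in> denominators A R.
           D \<odot>\<^bsub>presented_algebra A rels\<^esub> (Idl\<^bsub>free_algebra A\<^esub> rels +>\<^bsub>free_algebra A\<^esub> x) =
             \<zero>\<^bsub>presented_algebra A rels\<^esub>"
proof -
  let ?F = "free_algebra R :: ('x word \<Rightarrow>\<^sub>0 'k) ring" and ?I = "Idl\<^bsub>free_algebra R\<^esub> rels"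
  let ?G = "free_algebra A :: ('x word \<Rightarrow>\<^sub>0 'k) ring" and ?J = "Idl\<^bsub>free_algebra A\<^esub> rels"
  have R: "subring R ring_of_type_algebra" and A: "subring A ring_of_type_algebra" and AR: "A \<subseteq> R"
    using loc by (auto simp: is_localization_def)
  interpret F: ring ?F by (rule free_algebra_ring[OF R])
  interpret I: ideal ?I ?F using rels AR by (intro presented_ideal R) auto
  interpret J: ideal ?J ?G using rels by (intro presented_ideal A) auto
  have den: "D * E \<in> denominators A R" if "D \<in> denominators A R" "E \<in> denominators A R" for D E
    using that A R by (auto simp: denominators_def subring_type_iff)
  define L where "L = {y \<in> carrier ?F. \<exists>D \<in> denominators A R. scalar D * y \<in> ?J}"
  have LI: "y \<in> L" if "D \<in> denominators A R" "scalar D * y \<in> ?J" "y \<in> carrier ?F" for D y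
    using that unfolding L_def by blast
  have subF: "subring (carrier ?F) (ring_of_type_algebra :: ('x word \<Rightarrow>\<^sub>0 'k) ring)"
    using free_algebra_subring[OF R] by simp
  have Jl: "scalar D * y \<in> ?J" if "D \<in> denominators A R" "y \<in> ?J" for D y
    using J.I_l_closed[OF that(2) scalar_carrier[OF A, of D]] that(1) by (auto simp: denominators_def)
  have Jadd: "y + z \<in> ?J" if "y \<in> ?J" "z \<in> ?J" for y z
    using additive_subgroup.a_closed[OF J.additive_subgroup_axioms that] by simp
  have am: "- y = a_inv ?F y" if "y \<in> carrier ?F" for y :: "'x word \<Rightarrow>\<^sub>0 'k"
    using that subF F.minus_equality[of "- y" y] by (auto simp: subring_type_iff)
  have amJ: "- y \<in> ?J" if "y \<in> ?J" for y
  proof -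
    have "scalar (-1) * y \<in> ?J"
      using J.I_l_closed[OF that scalar_carrier[OF A, of "-1"]] A by (auto simp: subring_type_iff)
    moreover have "scalar (-1) * y = - y" by (rule poly_mapping_eqI) (simp add: scalar_mult_lookup)
    ultimately show ?thesis by simp
  qed
  have "ideal L ?F"
  proof (rule idealI[OF F.ring_axioms])
    show "subgroup L (add_monoid ?F)"
    proof (rule F.add.subgroupI)
      show "L \<subseteq> carrier ?F" by (auto simp: L_def)
      have "1 \<in> denominators A R" using A R by (auto simp: denominators_def subring_type_iff)
      moreover have "0 \<in> ?J" using additive_subgroup.zero_closed[OF J.additive_subgroup_axioms] by simp
      ultimately have "0 \<in> L" using F.zero_closed by (intro LI[of 1]) simp_all
      then show "L \<noteq> {}" by auto
    next
      fix y assume y: "y \<in> L"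
      then obtain D where *: "D \<in> denominators A R" "scalar D * y \<in> ?J" "y \<in> carrier ?F"
        by (auto simp: L_def)
      have "scalar D * (- y) \<in> ?J" using amJ[OF *(2)] by simp
      then show "\<ominus>\<^bsub>?F\<^esub> y \<in> L"
        using am[OF *(3)] F.a_inv_closed[OF *(3)] by (intro LI[OF *(1)]) (simp_all only:)
    next
      fix y z assume "y \<in> L" "z \<in> L"
      then obtain D E where *: "D \<in> denominators A R" "scalar D * y \<in> ?J" "y \<in> carrier ?F"
        "E \<in> denominators A R" "scalar E * z \<in> ?J" "z \<in> carrier ?F" by (auto simp: L_def)
      have "scalar (D * E) * (y + z) = scalar E * (scalar D * y) + scalar D * (scalar E * z)"
        by (rule poly_mapping_eqI) (simp add: scalar_mult_lookup lookup_add algebra_simps)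
      then have "scalar (D * E) * (y + z) \<in> ?J"
        using Jadd[OF Jl[OF *(4,2)] Jl[OF *(1,5)]] by simp
      then show "y \<oplus>\<^bsub>?F\<^esub> z \<in> L"
        using F.a_closed[OF *(3,6)] by (intro LI[OF den[OF *(1,4)]]) (simp_all only: free_algebra_simps(3))
    qed
  next
    fix a y assume "a \<in> L" and y: "y \<in> carrier ?F"
    then obtain D where D: "D \<in> denominators A R" "scalar D * a \<in> ?J" "a \<in> carrier ?F" by (auto simp: L_def)
    obtain E where E: "E \<in> denominators A R" "scalar E * y \<in> carrier ?G"
      using clear_denominators[OF loc y] by auto
    have "scalar (D * E) * (y * a) = (scalar E * y) * (scalar D * a)"
      by (metis (no_types, lifting) scalar_mult scalar_central mult.assoc)
    then have "scalar (D * E) * (y * a) \<in> ?J"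
      using J.I_l_closed[OF D(2) E(2)] by simp
    then show "y \<otimes>\<^bsub>?F\<^esub> a \<in> L"
      using F.m_closed[OF y D(3)] by (intro LI[OF den[OF D(1) E(1)]]) (simp_all only: free_algebra_simps(2))
    have "scalar (D * E) * (a * y) = (scalar D * a) * (scalar E * y)"
      by (metis (no_types, lifting) scalar_mult scalar_central mult.assoc)
    then have "scalar (D * E) * (a * y) \<in> ?J"
      using J.I_r_closed[OF D(2) E(2)] by simp
    then show "a \<otimes>\<^bsub>?F\<^esub> y \<in> L"
      using F.m_closed[OF D(3) y] by (intro LI[OF den[OF D(1) E(1)]]) (simp_all only: free_algebra_simps(2))
  qed
  moreover have "rels \<subseteq> L"
  proof
    fix r assume r: "r \<in> rels"
    have "1 \<in> denominators A R" using A R by (auto simp: denominators_def subring_type_iff)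
    moreover have "r \<in> ?J" using r ring.genideal_self[OF J.ring_axioms rels] by auto
    moreover have "r \<in> carrier ?F" using r rels AR by auto
    ultimately show "r \<in> L" by (intro LI[of 1]) simp_all
  qed
  ultimately have "?I \<subseteq> L" by (rule F.genideal_minimal)
  moreover have "x \<in> ?I"
  proof -
    have "x \<in> carrier ?F" using x AR by auto
    from I.a_rcos_self[OF this] show ?thesis using zero by (simp add: presented_algebra_simps)
  qed
  ultimately obtain D where D: "D \<in> denominators A R" "scalar D * x \<in> ?J" by (auto simp: L_def)
  have "D \<in> A" using D by (auto simp: denominators_def)
  then have "D \<odot>\<^bsub>presented_algebra A rels\<^esub> (?J +>\<^bsub>?G\<^esub> x) = ?J +>\<^bsub>?G\<^esub> (scalar D * x)"
    unfolding presented_algebra_simps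
    using J.rcoset_mult_add[OF scalar_carrier[OF A] x] by simp
  also have "\<dots> = ?J" by (rule J.a_rcos_const[OF D(2)])
  finally show ?thesis using D(1) by (intro bexI[of _ D]) (simp_all only: presented_algebra_simps(2))
qed

lemma q_nonzero: "q \<noteq> 0"
  by (simp add: q_def Zero_fract_def eq_fract)

lemma q_power: "q ^ n = Fract (monom 1 n) 1"
  by (induction n) (simp_all add: q_def One_fract_def monom_0 monom_Suc flip: one_pCons)

lemma q_power_minus_one_nonzero: "n \<ge> 1 \<Longrightarrow> q ^ n - 1 \<noteq> 0"
proof
  assume "n \<ge> 1" "q ^ n - 1 = 0"
  then have "monom 1 n = (1 :: complex poly)"
    by (simp add: q_power One_fract_def Zero_fract_def eq_fract)
  then have "Polynomial.degree (monom 1 n :: complex poly) = 0" by simp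
  with \<open>n \<ge> 1\<close> show False by (simp add: Polynomial.degree_monom_eq)
qed

lemma laurent_rouquier_localization: "is_localization (laurent_ring n) (rouquier_ring n)"
proof -
  let ?A = "laurent_ring n" and ?R = "rouquier_ring n"
  note A = laurent_subring[of n, unfolded subring_type_iff]
  note R = rouquier_subring[of n, unfolded subring_type_iff]
  have gA: "x \<in> ?A" if "x \<in> const ` cyclotomic_integers n \<union> {q, inverse q}" for x
    using that unfolding laurent_ring_def by (rule generate_ring.incl)
  have AR: "?A \<subseteq> ?R"
    unfolding laurent_ring_def rouquier_ring_def
    by (rule ring.mono_generate_ring[OF ring_of_type_ring_1]) (auto simp: ring_of_type_algebra_def)
  have gR: "inverse (q ^ i - 1) \<in> ?R" if "i \<ge> 1" for i :: nat
    unfolding rouquier_ring_def by (rule generate_ring.incl) (use that in blast)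
  have qA: "q ^ i \<in> ?A" for i
    using gA[of q] A by (induction i) auto
  have den: "D * E \<in> denominators ?A ?R" if "D \<in> denominators ?A ?R" "E \<in> denominators ?A ?R" for D E
    using that A R by (auto simp: denominators_def)
  have den1: "1 \<in> denominators ?A ?R" using A R by (auto simp: denominators_def)
  have "\<exists>D \<in> denominators ?A ?R. D * r \<in> ?A" if "r \<in> ?R" for r
    using that[unfolded rouquier_ring_def]
  proof (induction r rule: generate_ring.induct)
    case one
    then show ?case using A den1 by (auto simp: ring_of_type_algebra_def intro!: bexI[of _ 1])
  next
    case (incl h)
    then consider "h \<in> ?A" | i :: nat where "i \<ge> 1" "h = inverse (q ^ i - 1)" using gA by blast
    then show ?case
    proof cases
      case 1
      then show ?thesis using den1 by (auto intro!: bexI[of _ 1])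
    next
      case 2
      have "q ^ i + (- 1) \<in> ?A" using A qA by blast
      then have "q ^ i - 1 \<in> denominators ?A ?R"
        using gR[OF 2(1)] q_power_minus_one_nonzero[OF 2(1)] by (auto simp: denominators_def)
      then show ?thesis using 2 A q_power_minus_one_nonzero[OF 2(1)] by (auto intro!: bexI[of _ "q ^ i - 1"])
    qed
  next
    case (a_inv h)
    then show ?case using A by (auto simp: ring_of_type_a_inv)
  next
    case (eng_add h1 h2)
    then obtain D E where *: "D \<in> denominators ?A ?R" "D * h1 \<in> ?A" "E \<in> denominators ?A ?R" "E * h2 \<in> ?A" by auto
    have "D * E * (h1 + h2) = E * (D * h1) + D * (E * h2)" by (simp add: algebra_simps)
    moreover have "\<dots> \<in> ?A" using * A by (auto simp: denominators_def)
    ultimately have "D * E * (h1 + h2) \<in> ?A" by (simp only:)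
    then show ?case using den[OF *(1,3)] by (auto simp: ring_of_type_algebra_def)
  next
    case (eng_mult h1 h2)
    then obtain D E where *: "D \<in> denominators ?A ?R" "D * h1 \<in> ?A" "E \<in> denominators ?A ?R" "E * h2 \<in> ?A" by auto
    have "D * E * (h1 * h2) = (D * h1) * (E * h2)" by (simp add: algebra_simps)
    moreover have "\<dots> \<in> ?A" using * A by auto
    ultimately have "D * E * (h1 * h2) \<in> ?A" by (simp only:)
    then show ?case using den[OF *(1,3)] by (auto simp: ring_of_type_algebra_def)
  qed
  then show ?thesis
    using laurent_subring rouquier_subring AR unfolding is_localization_def denominators_def by fast
qed

lemma zeta_power: "n \<ge> 1 \<Longrightarrow> zeta n ^ n = 1"
  by (simp add: zeta_def flip: exp_of_nat_mult)

lemma zeta_power_integer: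
  assumes "p \<ge> 1" "d \<ge> 1" shows "zeta (p * d) ^ k \<in> cyclotomic_integers (2 * p * d)"
proof -
  have "zeta (p * d) = zeta (2 * p * d) ^ 2"
    using assms by (simp add: zeta_def mult.assoc flip: exp_of_nat_mult)
  moreover have pow: "z ^ i \<in> cyclotomic_field n" if "z \<in> cyclotomic_field n" for z i n
    using that
  proof (induction i)
    case 0
    show ?case using generate_field.one[of ring_of_type_algebra "{zeta n}"]
      by (simp add: cyclotomic_field_def ring_of_type_algebra_def)
  next
    case (Suc i)
    then show ?case using generate_field.eng_mult[of z ring_of_type_algebra "{zeta n}" "z ^ i"]
      by (simp add: cyclotomic_field_def ring_of_type_algebra_def)
  qed
  moreover have "zeta n \<in> cyclotomic_field n" for n
    by (simp add: cyclotomic_field_def generate_field.incl)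
  ultimately have 1: "zeta (p * d) ^ k \<in> cyclotomic_field (2 * p * d)" by metis
  have "(zeta (p * d) ^ k) ^ (p * d) = 1"
    using zeta_power[of "p * d"] assms by (simp flip: power_mult) (metis mult.commute power_mult power_one)
  then have "poly (monom 1 (p * d)) (zeta (p * d) ^ k) = 1"
    by (simp add: poly_monom)
  moreover have "algebraic_int (1::complex)" by (rule int_imp_algebraic_int) simp
  moreover have "\<forall>i. Polynomial.coeff (monom (1::complex) (p * d)) i \<in> \<int>"
    by simp
  moreover have "Polynomial.lead_coeff (monom (1::complex) (p * d)) = 1"
    "Polynomial.degree (monom (1::complex) (p * d)) > 0"
    using assms by (simp_all add: Polynomial.degree_monom_eq)
  ultimately have "algebraic_int (zeta (p * d) ^ k)"
    by (metis algebraic_int_root)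
  with 1 show ?thesis by (simp add: cyclotomic_integers_def)
qed

lemma hecke_relators_carrier:
  assumes "p \<ge> 1" "d \<ge> 1"
  shows "hecke_relators p d a0 a1 b0 b1 c \<subseteq> carrier (free_algebra (laurent_ring (2 * p * d)))"
proof -
  let ?A = "laurent_ring (2 * p * d)"
  define F :: "(gen word \<Rightarrow>\<^sub>0 complex poly fract) set" where "F = carrier (free_algebra ?A)"
  note A = laurent_subring[of "2 * p * d", unfolded subring_type_iff]
  have F: "1 \<in> F" "\<And>x. x \<in> F \<Longrightarrow> - x \<in> F" "\<And>x y. x \<in> F \<Longrightarrow> y \<in> F \<Longrightarrow> x + y \<in> F"
    "\<And>x y. x \<in> F \<Longrightarrow> y \<in> F \<Longrightarrow> x * y \<in> F"
    using free_algebra_subring[OF laurent_subring[of "2 * p * d"], where 'x = gen] unfolding subring_type_iff F_def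
    by simp_all
  then have Fd: "x - y \<in> F" if "x \<in> F" "y \<in> F" for x y
    using that by (metis diff_conv_add_uminus)
  have l: "letter g \<in> F" for g
    using A subring_zero[OF laurent_subring] by (auto simp: F_def letter_def lookup_single when_def)
  have gA: "x \<in> ?A" if "x \<in> const ` cyclotomic_integers (2 * p * d) \<union> {q, inverse q}" for x
    using that unfolding laurent_ring_def by (rule generate_ring.incl)
  have "x ^ i \<in> ?A" if "x \<in> ?A" for x i using that A by (induction i) auto
  then have qA: "q powi k \<in> ?A" for k using gA by (simp add: power_int_def)
  have s: "scalar x \<in> F" if "x \<in> ?A" for x
    unfolding F_def by (rule scalar_carrier[OF laurent_subring that])
  have zA: "const (zeta (p * d) ^ k) \<in> ?A" for k
    using gA zeta_power_integer[OF assms] by blast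
  have "prod_list xs \<in> F" if "set xs \<subseteq> F" for xs
    using that F by (induction xs) auto
  then have "prod_list (map (\<lambda>k. letter u_gen - scalar (const (zeta (p * d) ^ k) * q powi c (k mod d))) [0..<p * d]) \<in> F"
    using l s zA qA A Fd by (auto simp: image_subset_iff)
  then show ?thesis
    unfolding hecke_relators_def Let_def F_def[symmetric]
    using l s qA F Fd by auto
qed

lemma hecke_rouquier_denominators:
  fixes p d :: nat and a0 a1 b0 b1 :: int and c :: "nat \<Rightarrow> int"
  assumes "p \<ge> 1" "d \<ge> 1"
  defines "A \<equiv> laurent_ring (2 * p * d)" and "R \<equiv> rouquier_ring (2 * p * d)"
    and "rels \<equiv> hecke_relators p d a0 a1 b0 b1 c"
  assumes "y \<in> carrier (hecke R p d a0 a1 b0 b1 c)"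
  shows "\<exists>D \<in> denominators A R. \<exists>x \<in> carrier (free_algebra A).
           D \<odot>\<^bsub>hecke R p d a0 a1 b0 b1 c\<^esub> y = Idl\<^bsub>free_algebra R\<^esub> rels +>\<^bsub>free_algebra R\<^esub> x"
  using presented_denominators[OF laurent_rouquier_localization hecke_relators_carrier[OF assms(1,2)]] assms(6)
  unfolding hecke_def A_def R_def rels_def by blast

lemma hecke_rouquier_kernel:
  fixes p d :: nat and a0 a1 b0 b1 :: int and c :: "nat \<Rightarrow> int"
  assumes "p \<ge> 1" "d \<ge> 1"
  defines "A \<equiv> laurent_ring (2 * p * d)" and "R \<equiv> rouquier_ring (2 * p * d)"
    and "rels \<equiv> hecke_relators p d a0 a1 b0 b1 c"
  assumes "x \<in> carrier (free_algebra A)"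
    and "Idl\<^bsub>free_algebra R\<^esub> rels +>\<^bsub>free_algebra R\<^esub> x = \<zero>\<^bsub>hecke R p d a0 a1 b0 b1 c\<^esub>"
  shows "\<exists>D \<in> denominators A R.
           D \<odot>\<^bsub>hecke A p d a0 a1 b0 b1 c\<^esub> (Idl\<^bsub>free_algebra A\<^esub> rels +>\<^bsub>free_algebra A\<^esub> x) =
             \<zero>\<^bsub>hecke A p d a0 a1 b0 b1 c\<^esub>"
  using presented_kernel[OF laurent_rouquier_localization hecke_relators_carrier[OF assms(1,2)]] assms(6,7)
  unfolding hecke_def A_def R_def rels_def by blast


section \<open>Canonical symmetrizing forms\<close>

definition linear_form :: "'k::field set \<Rightarrow> ('k, 'b) module \<Rightarrow> ('b \<Rightarrow> 'k) \<Rightarrow> bool" where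
  "linear_form C M \<tau> \<longleftrightarrow>
     \<tau> \<in> carrier M \<rightarrow> C \<and>
     (\<forall>x \<in> carrier M. \<forall>y \<in> carrier M. \<tau> (x \<oplus>\<^bsub>M\<^esub> y) = \<tau> x + \<tau> y) \<and>
     (\<forall>k \<in> C. \<forall>x \<in> carrier M. \<tau> (k \<odot>\<^bsub>M\<^esub> x) = k * \<tau> x)"

definition symmetrizing_form :: "'k::field set \<Rightarrow> ('k, 'b) module \<Rightarrow> ('b \<Rightarrow> 'k) \<Rightarrow> bool" where
  "symmetrizing_form C M \<tau> \<longleftrightarrow>
     linear_form C M \<tau> \<and>
     (\<forall>x \<in> carrier M. \<forall>y \<in> carrier M. \<tau> (x \<otimes>\<^bsub>M\<^esub> y) = \<tau> (y \<otimes>\<^bsub>M\<^esub> x)) \<and>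
     (\<forall>\<phi>. linear_form C M \<phi> \<longrightarrow>
        (\<exists>!x. x \<in> carrier M \<and> (\<forall>y \<in> carrier M. \<phi> y = \<tau> (x \<otimes>\<^bsub>M\<^esub> y))))"

text \<open>
  The specialization \<open>q \<mapsto> 1\<close>, and the involution given by complex conjugation of the
  coefficients and \<open>q \<mapsto> q\<^sup>-\<^sup>1\<close> (for the generic Hecke algebra: inversion of all
  parameters).
\<close>

definition at_one :: "complex poly fract \<Rightarrow> complex" where
  "at_one x = (let (f, g) = quot_of_fract x in poly f 1 / poly g 1)"

definition bar_involution :: "complex poly fract \<Rightarrow> complex poly fract" where
  "bar_involution x =
     (let (f, g) = quot_of_fract x; ev = (\<lambda>h. poly (map_poly (const \<circ> cnj) h) (inverse q))
      in ev f / ev g)"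

text \<open>
  The reflection representation of \<open>G(n,2,2)\<close>, \<open>n\<close> even, on \<open>\<complex>\<^sup>2\<close>; the group is
  presented by \<open>s\<^sup>2 = t\<^sup>2 = u\<^sup>n\<^sup>/\<^sup>2 = 1\<close>, \<open>stu = tus = ust\<close>.
\<close>

fun reflection :: "nat \<Rightarrow> gen \<Rightarrow> complex \<times> complex \<Rightarrow> complex \<times> complex" where
  "reflection n s_gen (x, y) = (y, x)"
| "reflection n t_gen (x, y) = (inverse (zeta n) * y, zeta n * x)"
| "reflection n u_gen (x, y) = (x, zeta n ^ 2 * y)"

text \<open>
  The canonical symmetrizing form in the sense of Broue, Malle and Michel, for the algebra
  \<open>M\<close> generated by \<open>s, t, u\<^sup>m\<close> (\<open>m = 1\<close> for \<open>\<H>\<close> and \<open>m = p\<close> for its subalgebra): it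
  specializes at \<open>q = 1\<close> to the canonical form of the group algebra, and it satisfies
  \<open>\<tau>(b\<^sup>-\<^sup>1)\<^sup>\<or> = \<tau>(b\<pi>) / \<tau>(\<pi>)\<close> for all \<open>b\<close> in the image of the braid group, where
  \<open>\<pi> = (stu)\<^sup>n\<close> is the image of the full twist, \<open>n = |Z(G(n,2,2))|\<close>.
\<close>

definition canonical_symmetrizing_form ::
    "complex poly fract set \<Rightarrow> nat \<Rightarrow> nat \<Rightarrow> (complex poly fract, 'b) module \<Rightarrow> (gen \<Rightarrow> 'b) \<Rightarrow>
      ('b \<Rightarrow> complex poly fract) \<Rightarrow> bool" where
  "canonical_symmetrizing_form C n m M g \<tau> \<longleftrightarrow>
     symmetrizing_form C M \<tau> \<and>
     (\<forall>ws \<in> lists {[s_gen], [t_gen], replicate m u_gen}.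
        at_one (\<tau> (foldr (\<lambda>x y. g x \<otimes>\<^bsub>M\<^esub> y) (concat ws) \<one>\<^bsub>M\<^esub>)) =
        (if foldr (reflection n) (concat ws) = id then 1 else 0)) \<and>
     (let \<pi> = (g s_gen \<otimes>\<^bsub>M\<^esub> g t_gen \<otimes>\<^bsub>M\<^esub> g u_gen) [^]\<^bsub>M\<^esub> n in
      \<forall>b \<in> generate (units_of M) {g s_gen, g t_gen, g u_gen [^]\<^bsub>M\<^esub> m}.
        bar_involution (\<tau> (inv\<^bsub>M\<^esub> b)) = \<tau> (b \<otimes>\<^bsub>M\<^esub> \<pi>) / \<tau> \<pi>)"


section \<open>Block-idempotents\<close>

definition ring_center :: "('a, 'm) ring_scheme \<Rightarrow> 'a set" where
  "ring_center R = {z \<in> carrier R. \<forall>x \<in> carrier R. x \<otimes>\<^bsub>R\<^esub> z = z \<otimes>\<^bsub>R\<^esub> x}"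

definition idempotents :: "('a, 'm) ring_scheme \<Rightarrow> 'a set" where
  "idempotents R = {e \<in> carrier R. e \<otimes>\<^bsub>R\<^esub> e = e}"

definition primitive_idempotents :: "('a, 'm) ring_scheme \<Rightarrow> 'a set" where
  "primitive_idempotents R =
     {e \<in> idempotents R. e \<noteq> \<zero>\<^bsub>R\<^esub> \<and>
        (\<forall>f \<in> idempotents R. \<forall>g \<in> idempotents R.
           f \<otimes>\<^bsub>R\<^esub> g = \<zero>\<^bsub>R\<^esub> \<longrightarrow> g \<otimes>\<^bsub>R\<^esub> f = \<zero>\<^bsub>R\<^esub> \<longrightarrow> e = f \<oplus>\<^bsub>R\<^esub> g \<longrightarrow> f = \<zero>\<^bsub>R\<^esub> \<or> g = \<zero>\<^bsub>R\<^esub>)}"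

definition block_idempotents :: "('a, 'm) ring_scheme \<Rightarrow> 'a set" where
  "block_idempotents R = primitive_idempotents (R \<lparr>carrier := ring_center R\<rparr>)"

end

theory Submission
  imports Defs "Jordan_Normal_Form.Char_Poly"
begin

text \<open>
  The block-idempotents of a ring depend only on the set of its central idempotents, so it
  suffices that \<open>\<R>\<^sub>K(q)\<H>\<close> and \<open>\<R>\<^sub>K(q)\<bar>\<H>\<close> have the same central idempotents.

  A central element of the subalgebra is central in \<open>\<R>\<^sub>K(q)\<H>\<close>: the element \<open>stu\<close> is central
  there and \<open>st\<close> is a unit, so that whatever commutes with \<open>s\<close> and \<open>t\<close> also commutes with
  \<open>u = (st)\<^sup>-\<^sup>1(stu)\<close> (\<open>center_K_subset\<close>).

  Conversely, let \<open>e\<close> be a central idempotent of \<open>\<R>\<^sub>K(q)\<H>\<close>.  The relations are homogeneous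
  for the degree in \<open>u\<close> modulo \<open>p\<close>, because the parameters of \<open>u\<close> are permuted by
  multiplication with \<open>\<zeta>\<^sub>p\<close>.  Hence every \<open>p\<close>-th root of unity \<open>\<zeta>\<close> gives an automorphism
  \<open>\<sigma>\<^sub>\<zeta>\<close> fixing \<open>s\<close>, \<open>t\<close> and mapping \<open>u\<close> to \<open>\<zeta>u\<close>.  It induces the identity modulo \<open>1 - \<zeta>\<close>.  If
  the order of \<open>\<zeta>\<close> is a power of a prime \<open>l\<close>, then \<open>l\<close> divides a power of
  \<open>1 - \<zeta>\<close>, and no nonzero element of \<open>\<R>\<^sub>K(q)\<close> is divisible by all powers of
  \<open>1 - \<zeta>\<close> (\<open>rouquier_ring_separated\<close>).  The commuting idempotents \<open>e\<close> and \<open>\<sigma>\<^sub>\<zeta>(e)\<close> are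
  congruent modulo \<open>1 - \<zeta>\<close>; the idempotent \<open>e(1 - \<sigma>\<^sub>\<zeta>(e))\<close> is divisible by \<open>1 - \<zeta>\<close>, hence by
  all its powers, hence zero since the algebra is free; so \<open>e = \<sigma>\<^sub>\<zeta>(e)\<close>.
  The roots of unity of prime power order generate all \<open>p\<close>-th roots of unity, even if \<open>p\<close> is
  not a prime power, so \<open>e\<close> is fixed by all \<open>\<sigma>\<^sub>\<zeta>\<close> and has degree \<open>0\<close>
  (\<open>twist_fixes_central_idempotent\<close>).

  Finally, the part of degree \<open>0\<close> is the subalgebra: replacing each \<open>u\<close> by \<open>(st)\<^sup>-\<^sup>1z\<close> with
  the central element \<open>z = stu\<close> turns a word with \<open>n\<close> letters \<open>u\<close> into \<open>kz\<^sup>n\<close>, where \<open>k\<close> is in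
  the subalgebra generated by \<open>s\<close> and \<open>t\<close>, and \<open>z\<^sup>p = (st)\<^sup>pu\<^sup>p\<close> (\<open>u_degree_zero_in_K\<close>).
\<close>

section \<open>Algebraic integers\<close>

definition int_span :: "'a::comm_ring_1 set \<Rightarrow> 'a set" where
  "int_span V = {\<Sum>v\<in>V. of_int (a v) * v | a. True}"

lemma int_span_sum_mem: "(\<Sum>v\<in>V. of_int (a v) * v) \<in> int_span V"
  by (auto simp: int_span_def)

lemma int_span_add: "x \<in> int_span V \<Longrightarrow> y \<in> int_span V \<Longrightarrow> x + y \<in> int_span V"
proof -
  assume "x \<in> int_span V" "y \<in> int_span V"
  then obtain a b where "x = (\<Sum>v\<in>V. of_int (a v) * v)" "y = (\<Sum>v\<in>V. of_int (b v) * v)"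
    by (auto simp: int_span_def)
  then have "x + y = (\<Sum>v\<in>V. of_int (a v + b v) * v)"
    by (simp add: sum.distrib algebra_simps)
  then show ?thesis by (simp only: int_span_sum_mem)
qed

lemma int_span_scale: "x \<in> int_span V \<Longrightarrow> of_int k * x \<in> int_span V"
proof -
  assume "x \<in> int_span V"
  then obtain a where "x = (\<Sum>v\<in>V. of_int (a v) * v)"
    by (auto simp: int_span_def)
  then have "of_int k * x = (\<Sum>v\<in>V. of_int (k * a v) * v)"
    by (simp add: sum_distrib_left mult.assoc)
  then show ?thesis by (simp only: int_span_sum_mem)
qed

lemma int_span_zero: "0 \<in> int_span V"
  using int_span_sum_mem[of "\<lambda>_. 0" V] by simp

lemma int_span_sum: "(\<And>i. i \<in> I \<Longrightarrow> f i \<in> int_span V) \<Longrightarrow> sum f I \<in> int_span V"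
  by (induction I rule: infinite_finite_induct) (auto intro: int_span_add int_span_zero)

lemma int_span_base:
  assumes "finite V" "v \<in> V" shows "v \<in> int_span V"
proof -
  have "(\<Sum>w\<in>V. of_int (if w = v then 1 else 0) * w) = (\<Sum>w\<in>V. if w = v then w else 0)"
    by (rule sum.cong) auto
  also have "\<dots> = v" using assms by simp
  finally show ?thesis using int_span_sum_mem[of "\<lambda>w. if w = v then 1 else 0" V] by simp
qed

lemma int_span_mult_closed:
  assumes "\<And>v. v \<in> V \<Longrightarrow> x * v \<in> int_span V" and "y \<in> int_span V"
  shows "x * y \<in> int_span V"
proof -
  obtain a where a: "y = (\<Sum>v\<in>V. of_int (a v) * v)" using assms(2) by (auto simp: int_span_def)
  have "x * y = (\<Sum>v\<in>V. of_int (a v) * (x * v))"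
    by (simp add: a sum_distrib_left mult_ac)
  also have "\<dots> \<in> int_span V" by (intro int_span_sum int_span_scale assms(1))
  finally show ?thesis .
qed

text \<open>
  Integrality criterion: \<open>x\<close> is an eigenvalue of the integer matrix of multiplication by \<open>x\<close>,
  hence a root of its characteristic polynomial.
\<close>

lemma algebraic_int_of_stable_span:
  fixes x :: "'a::field_char_0"
  assumes fin: "finite V" and v0: "v0 \<in> V" "v0 \<noteq> 0"
    and stable: "\<And>v. v \<in> V \<Longrightarrow> x * v \<in> int_span V"
  shows "algebraic_int x"
proof -
  have "\<forall>v\<in>V. \<exists>a. x * v = (\<Sum>w\<in>V. of_int (a w) * w)"
    using stable by (auto simp: int_span_def)
  then obtain a :: "'a \<Rightarrow> 'a \<Rightarrow> int" where a: "\<And>v. v \<in> V \<Longrightarrow> x * v = (\<Sum>w\<in>V. of_int (a v w) * w)"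
    by metis
  define n where "n = card V"
  obtain f where f: "bij_betw f {0..<n} V"
    unfolding n_def using ex_bij_betw_nat_finite[OF fin] by blast
  define A where "A = mat n n (\<lambda>(i,j). a (f i) (f j))"
  have A: "A \<in> carrier_mat n n" by (simp add: A_def)
  define B where "B = map_mat (of_int :: int \<Rightarrow> 'a) A"
  have B: "B \<in> carrier_mat n n" using A by (simp add: B_def)
  have "vec n f \<noteq> 0\<^sub>v n"
  proof -
    obtain i where "i < n" "f i = v0" using f v0(1) by (auto simp: bij_betw_def)
    then have "vec_index (vec n f) i \<noteq> vec_index (0\<^sub>v n) i" using v0(2) by simp
    then show ?thesis by metis
  qed
  moreover have "B *\<^sub>v vec n f = x \<cdot>\<^sub>v vec n f"
  proof (rule eq_vecI)
    fix i assume "i < dim_vec (x \<cdot>\<^sub>v vec n f)"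
    then have i: "i < n" by simp
    then have fi: "f i \<in> V" using f by (auto simp: bij_betw_def)
    have "vec_index (B *\<^sub>v vec n f) i = (\<Sum>j\<in>{0..<n}. of_int (a (f i) (f j)) * f j)"
      using i B by (auto simp: B_def A_def scalar_prod_def intro!: sum.cong)
    also have "\<dots> = x * f i"
      unfolding a[OF fi] by (rule sum.reindex_bij_betw[OF f])
    finally show "vec_index (B *\<^sub>v vec n f) i = vec_index (x \<cdot>\<^sub>v vec n f) i" using i by simp
  qed (use B in simp)
  ultimately have "eigenvector B (vec n f) x"
    using B by (simp add: eigenvector_def)
  then have "poly (char_poly B) x = 0"
    using eigenvalue_root_char_poly[OF B] by (auto simp: eigenvalue_def)
  then have "poly (map_poly of_int (char_poly A)) x = 0"
    unfolding B_def by (simp add: of_int_hom.char_poly_hom[OF A])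
  moreover have "lead_coeff (char_poly A) = 1" using degree_monic_char_poly[OF A] by simp
  ultimately show ?thesis unfolding algebraic_int_altdef_ipoly by blast
qed

lemma algebraic_int_power_relation:
  fixes x :: "'a::field_char_0"
  assumes "algebraic_int x"
  obtains m and c :: "nat \<Rightarrow> int" where "m > 0" "x ^ m = (\<Sum>i<m. of_int (c i) * x ^ i)"
proof -
  obtain p where p: "poly (map_poly of_int p) x = 0" "lead_coeff p = 1"
    using assms unfolding algebraic_int_altdef_ipoly by blast
  define m where "m = degree p"
  have deg: "degree (map_poly (of_int :: int \<Rightarrow> 'a) p) = m"
    by (simp add: m_def degree_map_poly)
  have "m > 0"
  proof (rule ccontr)
    assume "\<not> m > 0"
    then have "p = [:1:]" using p(2) degree_eq_zeroE[of p] by (force simp: m_def)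
    then show False using p(1) by simp
  qed
  have "0 = (\<Sum>i\<le>m. of_int (coeff p i) * x ^ i)"
    using p(1) unfolding poly_altdef deg by (simp add: coeff_map_poly)
  also have "\<dots> = x ^ m + (\<Sum>i<m. of_int (coeff p i) * x ^ i)"
    using p(2) by (simp add: m_def flip: lessThan_Suc_atMost)
  finally have "x ^ m = (\<Sum>i<m. of_int (- coeff p i) * x ^ i)"
    by (simp add: sum_negf eq_neg_iff_add_eq_0)
  with \<open>m > 0\<close> show ?thesis by (rule that)
qed

text \<open>
  The span of the products \<open>x\<^sup>iy\<^sup>j\<close>, with exponents below the degrees of monic equations of \<open>x\<close>
  and \<open>y\<close>, is stable under multiplication by \<open>x\<close> and by \<open>y\<close>, hence by \<open>x + y\<close> and \<open>xy\<close>.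
\<close>

lemma algebraic_int_add_mult:
  fixes x y :: "'a::field_char_0"
  assumes "algebraic_int x" "algebraic_int y"
  shows algebraic_int_add: "algebraic_int (x + y)" and algebraic_int_mult: "algebraic_int (x * y)"
proof -
  obtain m c where m: "m > 0" "x ^ m = (\<Sum>i<m. of_int (c i) * x ^ i)"
    using algebraic_int_power_relation[OF assms(1)] by blast
  obtain n e where n: "n > 0" "y ^ n = (\<Sum>i<n. of_int (e i) * y ^ i)"
    using algebraic_int_power_relation[OF assms(2)] by blast
  define V where "V = (\<lambda>(i,j). x ^ i * y ^ j) ` ({..<m} \<times> {..<n})"
  have fin: "finite V" by (simp add: V_def)
  have mem: "x ^ i * y ^ j \<in> int_span V" if "i < m" "j < n" for i j
    by (rule int_span_base[OF fin]) (use that in \<open>auto simp: V_def\<close>)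
  have memm: "x ^ m * y ^ j \<in> int_span V" if "j < n" for j
    unfolding m(2) sum_distrib_right mult.assoc
    by (intro int_span_sum int_span_scale mem that) auto
  have memn: "x ^ i * y ^ n \<in> int_span V" if "i < m" for i
  proof -
    have "x ^ i * y ^ n = (\<Sum>j<n. of_int (e j) * (x ^ i * y ^ j))"
      unfolding n(2) by (simp add: sum_distrib_left mult_ac)
    also have "\<dots> \<in> int_span V" by (intro int_span_sum int_span_scale mem that) auto
    finally show ?thesis .
  qed
  have X: "x * v \<in> int_span V" if v0: "v \<in> V" for v
  proof -
    obtain i j where v: "i < m" "j < n" "v = x ^ i * y ^ j" using v0 by (auto simp: V_def)
    have "x ^ Suc i * y ^ j \<in> int_span V"
    proof (cases "Suc i = m")
      case True
      show ?thesis unfolding True by (rule memm[OF v(2)])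
    next
      case False
      with v(1) show ?thesis by (intro mem v(2)) simp
    qed
    then show ?thesis by (simp add: v(3) mult.assoc)
  qed
  have Y: "y * v \<in> int_span V" if v0: "v \<in> V" for v
  proof -
    obtain i j where v: "i < m" "j < n" "v = x ^ i * y ^ j" using v0 by (auto simp: V_def)
    have "x ^ i * y ^ Suc j \<in> int_span V"
    proof (cases "Suc j = n")
      case True
      show ?thesis unfolding True by (rule memn[OF v(1)])
    next
      case False
      with v(2) show ?thesis by (intro mem v(1)) simp
    qed
    then show ?thesis by (simp add: v(3) mult_ac)
  qed
  have one: "1 \<in> V" using m(1) n(1) by (auto simp: V_def intro!: image_eqI[of _ _ "(0, 0)"])
  show "algebraic_int (x + y)"
    by (rule algebraic_int_of_stable_span[OF fin one])
       (auto simp: distrib_right intro: int_span_add X Y)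
  show "algebraic_int (x * y)"
    by (rule algebraic_int_of_stable_span[OF fin one])
       (auto simp: mult.assoc intro: int_span_mult_closed X Y)
qed

lemma algebraic_int_sum:
  fixes f :: "'b \<Rightarrow> 'a::field_char_0"
  shows "(\<And>i. i \<in> I \<Longrightarrow> algebraic_int (f i)) \<Longrightarrow> algebraic_int (sum f I)"
  by (induction I rule: infinite_finite_induct) (auto intro: algebraic_int_add)

lemma algebraic_int_power: "algebraic_int x \<Longrightarrow> algebraic_int (x ^ n)" for x :: "'a::field_char_0"
  by (induction n) (auto intro: algebraic_int_mult)

lemma algebraic_int_poly:
  fixes x :: "'a::field_char_0"
  assumes "algebraic_int x" "\<And>i. algebraic_int (coeff p i)"
  shows "algebraic_int (poly p x)"
  unfolding poly_altdef by (intro algebraic_int_sum algebraic_int_mult algebraic_int_power assms)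

text \<open>
  The constant term of a monic integer polynomial of minimal degree with root \<open>x\<close> will do: if it
  were zero, a factor \<open>X\<close> could be cancelled.
\<close>

lemma algebraic_int_divides_integer:
  fixes x :: "'a::field_char_0"
  assumes "algebraic_int x" "x \<noteq> 0"
  obtains N :: int where "N \<noteq> 0" "algebraic_int (of_int N / x)"
proof -
  define P where "P p \<longleftrightarrow> lead_coeff p = 1 \<and> poly (map_poly of_int p) x = 0" for p :: "int poly"
  have "\<exists>p. P p" using assms(1) unfolding algebraic_int_altdef_ipoly P_def by blast
  then obtain p where p: "P p" and min: "\<And>r. P r \<Longrightarrow> degree p \<le> degree r"
    using arg_min_nat_lemma[of P _ degree] by (metis (no_types))
  obtain N r where pNr: "p = pCons N r" by (cases p)
  have r: "of_int N + x * poly (map_poly of_int r) x = 0"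
    using p unfolding P_def pNr of_int_hom.map_poly_pCons_hom by simp
  have "r \<noteq> 0"
  proof
    assume "r = 0"
    with p have "N = 1" "(of_int N :: 'a) = 0" by (auto simp: P_def pNr split: if_splits)
    then show False by simp
  qed
  have "N \<noteq> 0"
  proof
    assume "N = 0"
    then have "P r" using r p assms(2) \<open>r \<noteq> 0\<close> by (simp add: P_def pNr)
    from min[OF this] show False using \<open>r \<noteq> 0\<close> by (simp add: pNr)
  qed
  moreover have "of_int N / x = - poly (map_poly of_int r) x"
    using r assms(2) by (simp add: field_simps eq_neg_iff_add_eq_0)
  moreover have "algebraic_int (- poly (map_poly of_int r) x)"
    by (intro algebraic_int_minus algebraic_int_poly assms(1)) (simp add: coeff_map_poly)
  ultimately show ?thesis using that by metis
qed

lemma dvd_all_powers_zero: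
  fixes N l :: int
  assumes "l > 1" "\<And>n. l ^ n dvd N" shows "N = 0"
proof (rule ccontr)
  assume "N \<noteq> 0"
  have "int m < l ^ m" for m
  proof (induction m)
    case (Suc m)
    have "2 * l ^ m \<le> l * l ^ m" using assms(1) by (intro mult_right_mono) auto
    then show ?case using Suc by (simp, linarith)
  qed simp
  from this[of "nat \<bar>N\<bar>"] have "\<bar>N\<bar> < l ^ nat \<bar>N\<bar>" by simp
  then show False using assms(2)[of "nat \<bar>N\<bar>"] \<open>N \<noteq> 0\<close> zdvd_imp_le[of "l ^ nat \<bar>N\<bar>" "\<bar>N\<bar>"] by auto
qed

text \<open>
  The binomial expansion of \<open>(1 - \<omega>)\<^sup>n\<close> with \<open>n = l\<^sup>a\<close> has its middle terms divisible by \<open>l\<close>,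
  and the outer ones add up to \<open>0\<close> or to \<open>2 = l\<close>.
\<close>

lemma prime_dvd_one_minus_root_power:
  fixes \<omega> :: complex
  assumes l: "prime l" and om: "\<omega> ^ (l ^ a) = 1"
  shows "algebraic_int ((1 - \<omega>) ^ (l ^ a) / of_nat l)"
proof -
  define n where "n = l ^ a"
  have "algebraic_int \<omega>"
  proof (rule algebraic_int_root)
    show "poly (monom 1 n) \<omega> = 1" using om by (simp add: poly_monom n_def)
    show "degree (monom 1 n :: complex poly) > 0" using l by (simp add: n_def degree_monom_eq prime_gt_0_nat)
  qed (auto simp: degree_monom_eq)
  show ?thesis
  proof (cases "a = 0")
    case True
    with om show ?thesis by simp
  next
    case False
    have n0: "n > 0" using l by (simp add: n_def prime_gt_0_nat)
    have dv: "l dvd n choose k" if "0 < k" "k < n" for k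
    proof (rule ccontr)
      assume "\<not> l dvd n choose k"
      then have "coprime n (n choose k)"
        unfolding n_def using l by (simp add: prime_imp_coprime)
      moreover have "n dvd k * (n choose k)"
        using times_binomial_minus1_eq[OF \<open>0 < k\<close>, of n] by simp
      ultimately have "n dvd k" by (simp add: coprime_dvd_mult_left_iff)
      with that show False by (simp add: nat_dvd_not_less)
    qed
    have "(1 - \<omega>) ^ n = (\<Sum>k\<le>n. of_nat (n choose k) * (- \<omega>) ^ k)"
      using binomial_ring[of "- \<omega>" 1 n] by simp
    also have "{..n} = insert 0 (insert n {0<..<n})" using n0 by auto
    also have "(\<Sum>k\<in>\<dots>. of_nat (n choose k) * (- \<omega>) ^ k) =
        1 + (- \<omega>) ^ n + (\<Sum>k\<in>{0<..<n}. of_nat (n choose k) * (- \<omega>) ^ k)"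
      using n0 by simp
    also have "(- \<omega>) ^ n = (-1) ^ n" using om by (simp add: power_minus[of \<omega>] n_def)
    finally have eq: "(1 - \<omega>) ^ n / of_nat l =
        (1 + (-1) ^ n) / of_nat l + (\<Sum>k\<in>{0<..<n}. of_nat (n choose k) / of_nat l * (- \<omega>) ^ k)"
      by (simp add: add_divide_distrib sum_divide_distrib)
    have "algebraic_int ((1 + (-1) ^ n) / of_nat l :: complex)"
    proof (cases "l = 2")
      case True
      then show ?thesis using False by (simp add: n_def)
    next
      case neq: False
      then have "odd n" using l primes_dvd_imp_eq two_is_prime_nat unfolding n_def by (metis prime_dvd_power)
      then show ?thesis by simp
    qed
    moreover have "algebraic_int (of_nat (n choose k) / of_nat l * (- \<omega>) ^ k)" if "k \<in> {0<..<n}" for k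
    proof -
      have "l dvd n choose k" using dv[of k] that by simp
      then obtain b where "n choose k = l * b" ..
      then have "(of_nat (n choose k) / of_nat l :: complex) = of_nat b"
        using l by (auto simp: field_simps)
      then show ?thesis
        using \<open>algebraic_int \<omega>\<close> by (simp add: algebraic_int_mult algebraic_int_power)
    qed
    ultimately show ?thesis unfolding n_def[symmetric] eq
      by (intro algebraic_int_add algebraic_int_sum) auto
  qed
qed

text \<open>
  A nonzero \<open>x\<close> divides a nonzero integer \<open>N\<close>, so all powers of \<open>1 - \<omega>\<close> divide \<open>N\<close>.  As \<open>l\<close> divides
  a power of \<open>1 - \<omega>\<close>, all powers of \<open>l\<close> would divide \<open>N\<close>.
\<close>

lemma one_minus_root_adic_zero:
  fixes \<omega> x :: complex
  assumes l: "prime l" and om: "\<omega> ^ (l ^ a) = 1"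
    and x: "\<And>n. \<exists>y. algebraic_int y \<and> x = (1 - \<omega>) ^ n * y"
  shows "x = 0"
proof (rule ccontr)
  assume nz: "x \<noteq> 0"
  define \<pi> where "\<pi> = 1 - \<omega>"
  define M where "M = l ^ a"
  have "algebraic_int x" using x[of 0] by auto
  then obtain N :: int where N: "N \<noteq> 0" "algebraic_int (of_int N / x)"
    using algebraic_int_divides_integer nz by blast
  have pil: "algebraic_int (\<pi> ^ M / of_nat l)"
    using prime_dvd_one_minus_root_power[OF l om] by (simp add: \<pi>_def M_def)
  have "int l ^ n dvd N" for n
  proof -
    obtain y where y: "algebraic_int y" "x = \<pi> ^ (M * n) * y" using x[of "M * n"] by (auto simp: \<pi>_def)
    have "of_int N / of_nat l ^ n = of_int N / x * (y * (\<pi> ^ M / of_nat l) ^ n)"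
      using y(2) nz by (simp add: field_simps power_mult)
    moreover have "algebraic_int (of_int N / x * (y * (\<pi> ^ M / of_nat l) ^ n))"
      by (intro algebraic_int_mult algebraic_int_power N y pil)
    ultimately have "algebraic_int (of_int N / of_nat l ^ n :: complex)" by simp
    then have "(of_int N / of_nat l ^ n :: complex) \<in> \<int>"
      by (intro rational_algebraic_int_is_int) auto
    then obtain k where "of_int N / of_nat l ^ n = (of_int k :: complex)" by (auto elim: Ints_cases)
    then have "(of_int N :: complex) = of_int (int l ^ n * k)" using l by (auto simp: field_simps)
    then show ?thesis unfolding of_int_eq_iff by simp
  qed
  then show False using dvd_all_powers_zero[of "int l" N] N prime_gt_1_nat[OF l] by simp
qed

section \<open>Adic separatedness of the Rouquier ring\<close>

definition integral_poly :: "complex poly \<Rightarrow> bool" where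
  "integral_poly g \<longleftrightarrow> (\<forall>i. algebraic_int (Polynomial.coeff g i))"

lemma integral_poly_add: "integral_poly f \<Longrightarrow> integral_poly g \<Longrightarrow> integral_poly (f + g)"
  and integral_poly_mult: "integral_poly f \<Longrightarrow> integral_poly g \<Longrightarrow> integral_poly (f * g)"
  and integral_poly_minus: "integral_poly f \<Longrightarrow> integral_poly (- f)"
  by (auto simp: integral_poly_def Polynomial.coeff_mult intro: algebraic_int_add algebraic_int_sum algebraic_int_mult)

lemma integral_poly_simple:
  "integral_poly 1" "integral_poly (monom 1 n)"
  "algebraic_int c \<Longrightarrow> integral_poly [:c:]"
  by (auto simp: integral_poly_def coeff_pCons Polynomial.coeff_1 split: nat.splits)

text \<open>
  Denominators are monic, so that the leading coefficient of the numerator is multiplicative on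
  fractions and detects divisibility by constants.
\<close>

definition integral_fractions :: "complex poly fract set" where
  "integral_fractions =
     {Fract g h | g h. integral_poly g \<and> integral_poly h \<and> Polynomial.lead_coeff h = 1}"

lemma integral_fractionsI:
  "integral_poly g \<Longrightarrow> integral_poly h \<Longrightarrow> Polynomial.lead_coeff h = 1 \<Longrightarrow> Fract g h \<in> integral_fractions"
  by (auto simp: integral_fractions_def)

lemma rouquier_ring_subset_integral_fractions: "rouquier_ring n \<subseteq> integral_fractions"
proof
  fix r assume "r \<in> rouquier_ring n"
  then show "r \<in> integral_fractions"
    unfolding rouquier_ring_def
  proof (induction r rule: generate_ring.induct)
    case one
    have "Fract 1 1 \<in> integral_fractions" by (intro integral_fractionsI integral_poly_simple) simp
    then show ?case by (simp add: ring_of_type_algebra_def One_fract_def)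
  next
    case (incl h)
    then consider c where "c \<in> cyclotomic_integers n" "h = const c" | "h = q" | "h = inverse q"
      | i where "i \<ge> 1" "h = inverse (q ^ i - 1)" by blast
    then show ?case
    proof cases
      case 1
      then have "algebraic_int c" by (simp add: cyclotomic_integers_def)
      then show ?thesis unfolding 1(2) const_def by (intro integral_fractionsI integral_poly_simple) simp_all
    next
      case 2
      then have "h = Fract (monom 1 1) 1" by (simp add: q_power[of 1, simplified])
      then show ?thesis by (simp only:) (intro integral_fractionsI integral_poly_simple, simp)
    next
      case 3
      then have "h = Fract 1 (monom 1 1)" by (simp add: q_power[of 1, simplified] One_fract_def)
      then show ?thesis by (simp only:) (intro integral_fractionsI integral_poly_simple, simp add: Polynomial.degree_monom_eq)
    next
      case (4 i)
      have "q ^ i - 1 = Fract (monom 1 i - 1) 1" by (simp add: q_power One_fract_def)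
      then have h: "h = Fract 1 (monom 1 i + - 1)" by (simp add: 4)
      have "Polynomial.degree (monom 1 i + - 1 :: complex poly) = i"
        using 4(1) by (subst Polynomial.degree_add_eq_left) (auto simp: Polynomial.degree_monom_eq)
      then have "Polynomial.lead_coeff (monom 1 i + - 1 :: complex poly) = 1"
        using 4(1) by simp
      then show ?thesis unfolding h
        by (intro integral_fractionsI integral_poly_add integral_poly_minus integral_poly_simple)
    qed
  next
    case (a_inv h)
    then obtain f g where *: "h = Fract f g" "integral_poly f" "integral_poly g" "Polynomial.lead_coeff g = 1"
      by (auto simp: integral_fractions_def)
    then have "Fract (- f) g \<in> integral_fractions" by (intro integral_fractionsI integral_poly_minus)
    with * show ?case by simp
  next
    case (eng_add h1 h2)
    then obtain f g f' g' where *: "h1 = Fract f g" "integral_poly f" "integral_poly g" "Polynomial.lead_coeff g = 1"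
      "h2 = Fract f' g'" "integral_poly f'" "integral_poly g'" "Polynomial.lead_coeff g' = 1"
      by (auto simp: integral_fractions_def)
    then have "g \<noteq> 0" "g' \<noteq> 0" by auto
    then have "h1 + h2 = Fract (f * g' + f' * g) (g * g')" using * by simp
    also have "\<dots> \<in> integral_fractions" using *
      by (intro integral_fractionsI integral_poly_add integral_poly_mult) (auto simp: Polynomial.lead_coeff_mult)
    finally show ?case by (simp add: ring_of_type_algebra_def)
  next
    case (eng_mult h1 h2)
    then obtain f g f' g' where *: "h1 = Fract f g" "integral_poly f" "integral_poly g" "Polynomial.lead_coeff g = 1"
      "h2 = Fract f' g'" "integral_poly f'" "integral_poly g'" "Polynomial.lead_coeff g' = 1"
      by (auto simp: integral_fractions_def)
    have "h1 * h2 = Fract (f * f') (g * g')" using * by simp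
    also have "\<dots> \<in> integral_fractions" using *
      by (intro integral_fractionsI integral_poly_mult) (auto simp: Polynomial.lead_coeff_mult)
    finally show ?case by (simp add: ring_of_type_algebra_def)
  qed
qed

lemma const_mult: "const (a * b) = const a * const b"
  and const_one: "const 1 = 1" and const_add: "const (a + b) = const a + const b"
  and const_zero: "const 0 = 0"
  and const_diff: "const (a - b) = const a - const b"
  by (simp_all add: const_def one_pCons[symmetric] One_fract_def Zero_fract_def eq_fract)

lemma const_power: "const (a ^ n) = const a ^ n"
  by (induction n) (simp_all add: const_mult const_one)

lemma const_eq_zero_iff: "const a = 0 \<longleftrightarrow> a = 0"
  by (simp add: const_def Zero_fract_def eq_fract)

text \<open>
  If a constant divides a fraction, then it divides the leading coefficient of the numerator: monic
  denominators do not affect it.  This reduces the claim to algebraic integers.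
\<close>

lemma rouquier_ring_separated:
  assumes l: "prime l" and om: "\<omega> ^ (l ^ a) = 1" and r: "r \<in> rouquier_ring n"
    and div: "\<And>k. \<exists>y\<in>rouquier_ring n. r = const (1 - \<omega>) ^ k * y"
  shows "r = 0"
proof -
  obtain g h where gh: "r = Fract g h" "integral_poly g" "integral_poly h" "Polynomial.lead_coeff h = 1"
    using r rouquier_ring_subset_integral_fractions unfolding integral_fractions_def by blast
  have "\<exists>y. algebraic_int y \<and> Polynomial.lead_coeff g = (1 - \<omega>) ^ k * y" for k
  proof -
    obtain f d where fd: "r = const (1 - \<omega>) ^ k * Fract f d" "integral_poly f" "integral_poly d"
      "Polynomial.lead_coeff d = 1"
      using div[of k] rouquier_ring_subset_integral_fractions by (force simp: integral_fractions_def)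
    have nz: "h \<noteq> 0" "d \<noteq> 0" using gh fd by auto
    have "Fract g h = Fract (smult ((1 - \<omega>) ^ k) f) d"
      using fd(1) gh(1) unfolding const_power[symmetric] by (simp add: const_def)
    then have "g * d = smult ((1 - \<omega>) ^ k) f * h" using nz by (simp add: eq_fract)
    then have "Polynomial.lead_coeff (g * d) = Polynomial.lead_coeff (smult ((1 - \<omega>) ^ k) f * h)" by simp
    then have "Polynomial.lead_coeff g = (1 - \<omega>) ^ k * Polynomial.lead_coeff f"
      by (simp only: Polynomial.lead_coeff_mult Polynomial.lead_coeff_smult gh(4) fd(4) mult_1_right)
    then show ?thesis using fd(2) by (auto simp: integral_poly_def)
  qed
  then have "Polynomial.lead_coeff g = 0" by (rule one_minus_root_adic_zero[OF l om])
  then show ?thesis by (simp add: gh(1) rat_number_collapse fract_collapse)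
qed

section \<open>Algebras given by generators and relations\<close>

text \<open>
  Elements of the presented algebra are handled through representatives: equations between the
  classes \<open>cls x\<close> become memberships in the ideal \<open>I\<close> of the free algebra, whose operations are those
  of a type class.
\<close>

locale presentation =
  fixes C :: "'k::field set" and rels :: "('x word \<Rightarrow>\<^sub>0 'k) set"
  assumes subring_C: "subring C ring_of_type_algebra"
    and rels_carrier: "rels \<subseteq> carrier (free_algebra C)"
begin

abbreviation F where "F \<equiv> carrier (free_algebra C :: ('x word \<Rightarrow>\<^sub>0 'k) ring)"
abbreviation I where "I \<equiv> Idl\<^bsub>free_algebra C\<^esub> rels"
abbreviation M where "M \<equiv> presented_algebra C rels"

definition cls :: "('x word \<Rightarrow>\<^sub>0 'k) \<Rightarrow> ('x word \<Rightarrow>\<^sub>0 'k) set" where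
  "cls x = I +>\<^bsub>free_algebra C\<^esub> x"

sublocale I: ideal I "free_algebra C :: ('x word \<Rightarrow>\<^sub>0 'k) ring"
  by (rule presented_ideal[OF subring_C rels_carrier])

lemma C_closed:
  "1 \<in> C" "0 \<in> C" "c \<in> C \<Longrightarrow> - c \<in> C" "c \<in> C \<Longrightarrow> e \<in> C \<Longrightarrow> c + e \<in> C"
  "c \<in> C \<Longrightarrow> e \<in> C \<Longrightarrow> c * e \<in> C" "c \<in> C \<Longrightarrow> e \<in> C \<Longrightarrow> c - e \<in> C"
proof -
  note * = subring_C[unfolded subring_type_iff] subring_zero[OF subring_C]
  show "1 \<in> C" "0 \<in> C" "c \<in> C \<Longrightarrow> - c \<in> C" "c \<in> C \<Longrightarrow> e \<in> C \<Longrightarrow> c + e \<in> C"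
    "c \<in> C \<Longrightarrow> e \<in> C \<Longrightarrow> c * e \<in> C" using * by auto
  then show "c \<in> C \<Longrightarrow> e \<in> C \<Longrightarrow> c - e \<in> C" using * by (metis diff_conv_add_uminus)
qed

lemma F_closed:
  "1 \<in> F" "0 \<in> F" "x \<in> F \<Longrightarrow> - x \<in> F" "x \<in> F \<Longrightarrow> y \<in> F \<Longrightarrow> x + y \<in> F"
  "x \<in> F \<Longrightarrow> y \<in> F \<Longrightarrow> x * y \<in> F" "x \<in> F \<Longrightarrow> y \<in> F \<Longrightarrow> x - y \<in> F" "c \<in> C \<Longrightarrow> scalar c \<in> F"
proof -
  have *: "subring F ring_of_type_algebra"
    using free_algebra_subring[OF subring_C] by simp
  note ** = *[unfolded subring_type_iff]
  show "0 \<in> F" by (rule subring_zero[OF *])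
  show "1 \<in> F" "x \<in> F \<Longrightarrow> - x \<in> F" "x \<in> F \<Longrightarrow> y \<in> F \<Longrightarrow> x + y \<in> F"
    "x \<in> F \<Longrightarrow> y \<in> F \<Longrightarrow> x * y \<in> F" using ** by blast+
  show "x \<in> F \<Longrightarrow> y \<in> F \<Longrightarrow> x - y \<in> F" using ** by (metis diff_conv_add_uminus)
  show "c \<in> C \<Longrightarrow> scalar c \<in> F" by (rule scalar_carrier[OF subring_C])
qed

lemma F_sum: "(\<And>i. i \<in> J \<Longrightarrow> f i \<in> F) \<Longrightarrow> sum f J \<in> F"
  by (induction J rule: infinite_finite_induct) (simp_all add: F_closed del: free_algebra_simps(1))

lemma letter_F: "letter g \<in> F"
  using C_closed by (auto simp: letter_def lookup_single when_def)

lemma a_inv_F: "x \<in> F \<Longrightarrow> \<ominus>\<^bsub>free_algebra C\<^esub> x = - x"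
  using I.minus_equality[of "- x" x] F_closed(3)[of x] by (simp del: free_algebra_simps(1))

lemma I_closed:
  "0 \<in> I" "x \<in> I \<Longrightarrow> - x \<in> I" "x \<in> I \<Longrightarrow> y \<in> I \<Longrightarrow> x + y \<in> I" "x \<in> I \<Longrightarrow> y \<in> I \<Longrightarrow> x - y \<in> I"
  "x \<in> I \<Longrightarrow> y \<in> F \<Longrightarrow> x * y \<in> I" "x \<in> I \<Longrightarrow> y \<in> F \<Longrightarrow> y * x \<in> I" "x \<in> I \<Longrightarrow> x \<in> F"
proof -
  show "x \<in> I \<Longrightarrow> x \<in> F" for x by (rule I.Icarr)
  then show m: "x \<in> I \<Longrightarrow> - x \<in> I" for x
    using additive_subgroup.a_inv_closed[OF I.additive_subgroup_axioms] a_inv_F by metis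
  show "0 \<in> I" using additive_subgroup.zero_closed[OF I.additive_subgroup_axioms] by simp
  show a: "x \<in> I \<Longrightarrow> y \<in> I \<Longrightarrow> x + y \<in> I" for x y
    using additive_subgroup.a_closed[OF I.additive_subgroup_axioms, of x y] by simp
  show "x \<in> I \<Longrightarrow> y \<in> I \<Longrightarrow> x - y \<in> I"
    using a[of x "- y"] m[of y] by simp
  show "x \<in> I \<Longrightarrow> y \<in> F \<Longrightarrow> x * y \<in> I" "x \<in> I \<Longrightarrow> y \<in> F \<Longrightarrow> y * x \<in> I"
    using I.I_r_closed[of x y] I.I_l_closed[of x y] by (simp_all del: free_algebra_simps(1))
qed

lemma I_sum: "(\<And>i. i \<in> J \<Longrightarrow> f i \<in> I) \<Longrightarrow> sum f J \<in> I"
  by (induction J rule: infinite_finite_induct) (auto intro: I_closed)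

lemma rels_I: "rels \<subseteq> I"
  by (rule I.genideal_self[OF rels_carrier])

lemma I_minimal:
  assumes "J \<subseteq> F" "0 \<in> J" "\<And>x. x \<in> J \<Longrightarrow> - x \<in> J" "\<And>x y. x \<in> J \<Longrightarrow> y \<in> J \<Longrightarrow> x + y \<in> J"
    "\<And>x y. x \<in> J \<Longrightarrow> y \<in> F \<Longrightarrow> x * y \<in> J" "\<And>x y. x \<in> J \<Longrightarrow> y \<in> F \<Longrightarrow> y * x \<in> J" "rels \<subseteq> J"
  shows "I \<subseteq> J"
proof (rule I.genideal_minimal)
  show "ideal J (free_algebra C)"
  proof (rule idealI[OF I.ring_axioms])
    show "subgroup J (add_monoid (free_algebra C))"
      by (rule I.add.subgroupI) (use assms a_inv_F in \<open>auto simp del: free_algebra_simps(1)\<close>)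
  qed (use assms in \<open>auto simp del: free_algebra_simps(1)\<close>)
qed (rule assms(7))

lemma carrier_M: "carrier M = cls ` F"
  by (auto simp: presented_algebra_simps A_RCOSETS_def' cls_def simp del: free_algebra_simps(1))

lemma cls_closed: "x \<in> F \<Longrightarrow> cls x \<in> carrier M"
  by (simp add: carrier_M del: free_algebra_simps(1))

lemma cls_eq_iff: "x \<in> F \<Longrightarrow> y \<in> F \<Longrightarrow> cls x = cls y \<longleftrightarrow> x - y \<in> I"
proof -
  assume x: "x \<in> F" and y: "y \<in> F"
  have "x - y = x \<ominus>\<^bsub>free_algebra C\<^esub> y" using y by (simp add: a_minus_def a_inv_F del: free_algebra_simps(1))
  then show ?thesis
    unfolding cls_def using I.quotient_eq_iff_same_a_r_cos[OF I.ideal_axioms x y] by simp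
qed

lemma M_simps:
  "x \<in> F \<Longrightarrow> y \<in> F \<Longrightarrow> cls x \<oplus>\<^bsub>M\<^esub> cls y = cls (x + y)"
  "x \<in> F \<Longrightarrow> y \<in> F \<Longrightarrow> cls x \<otimes>\<^bsub>M\<^esub> cls y = cls (x * y)"
  "\<one>\<^bsub>M\<^esub> = cls 1" "\<zero>\<^bsub>M\<^esub> = cls 0"
  "c \<in> C \<Longrightarrow> x \<in> F \<Longrightarrow> c \<odot>\<^bsub>M\<^esub> cls x = cls (scalar c * x)"
proof -
  let ?F = "free_algebra C :: ('x word \<Rightarrow>\<^sub>0 'k) ring"
  have add: "x \<oplus>\<^bsub>M\<^esub> y = x <+>\<^bsub>?F\<^esub> y" and mult: "x \<otimes>\<^bsub>M\<^esub> y = rcoset_mult ?F I x y"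
    and one: "\<one>\<^bsub>M\<^esub> = cls 1" for x y
    by (simp_all add: presented_algebra_def ring.defs module.defs Let_def FactRing_def cls_def)
  show "x \<in> F \<Longrightarrow> y \<in> F \<Longrightarrow> cls x \<oplus>\<^bsub>M\<^esub> cls y = cls (x + y)"
    using I.a_rcos_sum[of x y] by (simp add: add cls_def del: free_algebra_simps(1))
  show "x \<in> F \<Longrightarrow> y \<in> F \<Longrightarrow> cls x \<otimes>\<^bsub>M\<^esub> cls y = cls (x * y)"
    using I.rcoset_mult_add[of x y] by (simp add: mult cls_def del: free_algebra_simps(1))
  show "c \<in> C \<Longrightarrow> x \<in> F \<Longrightarrow> c \<odot>\<^bsub>M\<^esub> cls x = cls (scalar c * x)"
    using I.rcoset_mult_add[OF scalar_carrier[OF subring_C], of c x]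
    by (simp add: presented_algebra_simps cls_def del: free_algebra_simps(1))
  show "\<one>\<^bsub>M\<^esub> = cls 1" by (rule one)
  show "\<zero>\<^bsub>M\<^esub> = cls 0"
    using I.a_rcos_zero[OF I.ideal_axioms, of 0] I_closed(1) by (simp add: presented_algebra_simps(2) cls_def)
qed

lemma cls_eq_zero_iff: "x \<in> F \<Longrightarrow> cls x = \<zero>\<^bsub>M\<^esub> \<longleftrightarrow> x \<in> I"
  by (simp add: M_simps(4) cls_eq_iff F_closed(2) del: free_algebra_simps(1))

lemma ring_M: "ring M"
proof (intro ringI abelian_groupI monoidI)
  fix x assume "x \<in> carrier M"
  then obtain y where y: "y \<in> F" "x = cls y" unfolding carrier_M by blast
  then show "\<exists>z\<in>carrier M. z \<oplus>\<^bsub>M\<^esub> x = \<zero>\<^bsub>M\<^esub>"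
    by (intro bexI[of _ "cls (- y)"]) (simp_all add: M_simps cls_closed F_closed(3) del: free_algebra_simps(1))
qed (auto simp: carrier_M M_simps F_closed algebra_simps simp del: free_algebra_simps(1))

sublocale M: ring M by (rule ring_M)

lemma smult_closed: "c \<in> C \<Longrightarrow> x \<in> carrier M \<Longrightarrow> c \<odot>\<^bsub>M\<^esub> x \<in> carrier M"
proof -
  assume c: "c \<in> C" "x \<in> carrier M"
  then obtain z where "z \<in> F" "x = cls z" unfolding carrier_M by blast
  with c show ?thesis by (simp add: M_simps F_closed C_closed cls_closed del: free_algebra_simps(1))
qed

lemma smult_conv_mult: "c \<in> C \<Longrightarrow> x \<in> carrier M \<Longrightarrow> c \<odot>\<^bsub>M\<^esub> x = cls (scalar c) \<otimes>\<^bsub>M\<^esub> x"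
proof -
  assume c: "c \<in> C" "x \<in> carrier M"
  then obtain z where "z \<in> F" "x = cls z" unfolding carrier_M by blast
  with c show ?thesis by (simp add: M_simps F_closed C_closed  del: free_algebra_simps(1))
qed

lemma scalar_commute: "c \<in> C \<Longrightarrow> x \<in> carrier M \<Longrightarrow> cls (scalar c) \<otimes>\<^bsub>M\<^esub> x = x \<otimes>\<^bsub>M\<^esub> cls (scalar c)"
proof -
  assume c: "c \<in> C" "x \<in> carrier M"
  then obtain z where "z \<in> F" "x = cls z" unfolding carrier_M by blast
  with c show ?thesis by (simp add: M_simps F_closed C_closed scalar_central del: free_algebra_simps(1))
qed

lemma scalar_add: "scalar (c + e) = (scalar c + scalar e :: 'x word \<Rightarrow>\<^sub>0 'k)"
  by (simp add: scalar_def single_add)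

lemma smult_add_left: "c \<in> C \<Longrightarrow> e \<in> C \<Longrightarrow> x \<in> carrier M \<Longrightarrow> (c + e) \<odot>\<^bsub>M\<^esub> x = c \<odot>\<^bsub>M\<^esub> x \<oplus>\<^bsub>M\<^esub> e \<odot>\<^bsub>M\<^esub> x"
proof -
  assume c: "c \<in> C" "e \<in> C" "x \<in> carrier M"
  then obtain z where "z \<in> F" "x = cls z" unfolding carrier_M by blast
  with c show ?thesis by (simp add: M_simps F_closed C_closed scalar_add distrib_right del: free_algebra_simps(1))
qed

lemma smult_smult: "c \<in> C \<Longrightarrow> e \<in> C \<Longrightarrow> x \<in> carrier M \<Longrightarrow> c \<odot>\<^bsub>M\<^esub> (e \<odot>\<^bsub>M\<^esub> x) = (c * e) \<odot>\<^bsub>M\<^esub> x"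
proof -
  assume c: "c \<in> C" "e \<in> C" "x \<in> carrier M"
  then obtain z where "z \<in> F" "x = cls z" unfolding carrier_M by blast
  with c show ?thesis by (simp add: M_simps F_closed C_closed scalar_mult mult.assoc del: free_algebra_simps(1))
qed

lemma smult_zero_left: "x \<in> carrier M \<Longrightarrow> 0 \<odot>\<^bsub>M\<^esub> x = \<zero>\<^bsub>M\<^esub>"
proof -
  assume c: "x \<in> carrier M"
  then obtain z where "z \<in> F" "x = cls z" unfolding carrier_M by blast
  moreover have "scalar 0 * z = 0" for z :: "'x word \<Rightarrow>\<^sub>0 'k" by (simp add: scalar_def)
  ultimately show ?thesis by (simp add: M_simps F_closed C_closed del: free_algebra_simps(1))
qed

lemma smult_add_right: "c \<in> C \<Longrightarrow> x \<in> carrier M \<Longrightarrow> y \<in> carrier M \<Longrightarrow> c \<odot>\<^bsub>M\<^esub> (x \<oplus>\<^bsub>M\<^esub> y) = c \<odot>\<^bsub>M\<^esub> x \<oplus>\<^bsub>M\<^esub> c \<odot>\<^bsub>M\<^esub> y"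
  by (simp add: smult_conv_mult M.r_distr cls_closed F_closed del: free_algebra_simps(1))

lemma linear_form_zero: "linear_form C M \<phi> \<Longrightarrow> \<phi> \<zero>\<^bsub>M\<^esub> = 0"
  unfolding linear_form_def
  by (metis C_closed(2) M.zero_closed mult_zero_left smult_zero_left)

text \<open>
  Coordinates with respect to a basis are linear forms.  Linear forms are the way in which freeness
  is used later on: they survive localization, and they carry divisibility in the algebra to
  divisibility in the coefficient ring.
\<close>

lemma free_separating_linear_form:
  assumes free: "free_of_rank C M r" and y: "y \<in> carrier M" "y \<noteq> \<zero>\<^bsub>M\<^esub>"
  shows "\<exists>\<phi>. linear_form C M \<phi> \<and> \<phi> y \<noteq> 0"
proof -
  obtain B where "finite B \<and> card B = r \<and> B \<subseteq> carrier M \<and>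
      (\<forall>x\<in>carrier M. \<exists>!f. f \<in> B \<rightarrow>\<^sub>E C \<and> x = (\<Oplus>\<^bsub>M\<^esub>b\<in>B. f b \<odot>\<^bsub>M\<^esub> b))"
    using free unfolding free_of_rank_def ..
  then have B: "finite B" "B \<subseteq> carrier M"
    and ex1: "\<And>x. x \<in> carrier M \<Longrightarrow> \<exists>!f. f \<in> B \<rightarrow>\<^sub>E C \<and> x = (\<Oplus>\<^bsub>M\<^esub>b\<in>B. f b \<odot>\<^bsub>M\<^esub> b)"
    by simp_all
  define \<kappa> where "\<kappa> x = (THE f. f \<in> B \<rightarrow>\<^sub>E C \<and> x = (\<Oplus>\<^bsub>M\<^esub>b\<in>B. f b \<odot>\<^bsub>M\<^esub> b))" for x
  have \<kappa>: "\<kappa> x \<in> B \<rightarrow>\<^sub>E C" "x = (\<Oplus>\<^bsub>M\<^esub>b\<in>B. \<kappa> x b \<odot>\<^bsub>M\<^esub> b)" if "x \<in> carrier M" for x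
    using theI'[OF ex1[OF that]] unfolding \<kappa>_def by (rule conjunct1, rule conjunct2)
  have \<kappa>C: "\<kappa> x b \<in> C" if "x \<in> carrier M" "b \<in> B" for x b using \<kappa>(1)[OF that(1)] that(2) by auto
  have uniq: "\<kappa> x b = f b" if "x \<in> carrier M" "f \<in> B \<rightarrow>\<^sub>E C" "x = (\<Oplus>\<^bsub>M\<^esub>b\<in>B. f b \<odot>\<^bsub>M\<^esub> b)" for x f b
  proof -
    have "\<kappa> x = f" unfolding \<kappa>_def
      by (rule the1_equality[OF ex1[OF that(1)]]) (rule conjI[OF that(2,3)])
    then show ?thesis by simp
  qed
  have scaled: "c \<odot>\<^bsub>M\<^esub> b \<in> carrier M" if "b \<in> B" "c \<in> C" for b c
    using that B(2) smult_closed by auto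
  have lin: "linear_form C M (\<lambda>x. \<kappa> x b)" if b: "b \<in> B" for b
    unfolding linear_form_def
  proof (intro conjI ballI)
    show "(\<lambda>x. \<kappa> x b) \<in> carrier M \<rightarrow> C" using \<kappa>C b by auto
  next
    fix x z assume x: "x \<in> carrier M" and z: "z \<in> carrier M"
    let ?f = "\<lambda>b\<in>B. \<kappa> x b + \<kappa> z b"
    have "x \<oplus>\<^bsub>M\<^esub> z = (\<Oplus>\<^bsub>M\<^esub>b\<in>B. \<kappa> x b \<odot>\<^bsub>M\<^esub> b) \<oplus>\<^bsub>M\<^esub> (\<Oplus>\<^bsub>M\<^esub>b\<in>B. \<kappa> z b \<odot>\<^bsub>M\<^esub> b)"
      using \<kappa>(2)[OF x] \<kappa>(2)[OF z] by simp
    also have "\<dots> = (\<Oplus>\<^bsub>M\<^esub>b\<in>B. \<kappa> x b \<odot>\<^bsub>M\<^esub> b \<oplus>\<^bsub>M\<^esub> \<kappa> z b \<odot>\<^bsub>M\<^esub> b)"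
      by (rule M.finsum_addf[symmetric]) (use scaled \<kappa>C x z in auto)
    also have "\<dots> = (\<Oplus>\<^bsub>M\<^esub>b\<in>B. ?f b \<odot>\<^bsub>M\<^esub> b)"
      by (rule M.finsum_cong') (use scaled \<kappa>C x z B(2) C_closed in \<open>auto simp: smult_add_left subset_iff\<close>)
    finally have "\<kappa> (x \<oplus>\<^bsub>M\<^esub> z) b = ?f b"
      using \<kappa>C x z C_closed by (intro uniq[OF M.a_closed[OF x z]]) auto
    then show "\<kappa> (x \<oplus>\<^bsub>M\<^esub> z) b = \<kappa> x b + \<kappa> z b" using b by simp
  next
    fix k x assume k: "k \<in> C" and x: "x \<in> carrier M"
    let ?f = "\<lambda>b\<in>B. k * \<kappa> x b"
    have "k \<odot>\<^bsub>M\<^esub> x = cls (scalar k) \<otimes>\<^bsub>M\<^esub> (\<Oplus>\<^bsub>M\<^esub>b\<in>B. \<kappa> x b \<odot>\<^bsub>M\<^esub> b)"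
      using \<kappa>(2)[OF x] smult_conv_mult[OF k x] by simp
    also have "\<dots> = (\<Oplus>\<^bsub>M\<^esub>b\<in>B. cls (scalar k) \<otimes>\<^bsub>M\<^esub> (\<kappa> x b \<odot>\<^bsub>M\<^esub> b))"
      by (rule M.finsum_rdistr) (use scaled \<kappa>C x k B(1) in \<open>auto intro: cls_closed F_closed\<close>)
    also have "\<dots> = (\<Oplus>\<^bsub>M\<^esub>b\<in>B. ?f b \<odot>\<^bsub>M\<^esub> b)"
      by (rule M.finsum_cong')
         (use scaled \<kappa>C x k B(2) C_closed in \<open>auto simp: smult_conv_mult[symmetric] smult_smult subset_iff\<close>)
    finally have "\<kappa> (k \<odot>\<^bsub>M\<^esub> x) b = ?f b"
      using \<kappa>C x k C_closed by (intro uniq[OF smult_closed[OF k x]]) auto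
    then show "\<kappa> (k \<odot>\<^bsub>M\<^esub> x) b = k * \<kappa> x b" using b by simp
  qed
  have "\<exists>b\<in>B. \<kappa> y b \<noteq> 0"
  proof (rule ccontr)
    assume "\<not> ?thesis"
    then have "(\<Oplus>\<^bsub>M\<^esub>b\<in>B. \<kappa> y b \<odot>\<^bsub>M\<^esub> b) = (\<Oplus>\<^bsub>M\<^esub>b\<in>B. \<zero>\<^bsub>M\<^esub>)"
      by (intro M.finsum_cong') (use B(2) in \<open>auto simp: smult_zero_left subset_iff\<close>)
    then show False using \<kappa>(2)[OF y(1)] y(2) by simp
  qed
  then show ?thesis using lin by blast
qed

end

text \<open>
  A linear form \<open>\<psi>\<close> over \<open>A\<close> extends to the localization by \<open>\<phi>(y) = \<psi>(x) / D\<close>, where \<open>x\<close> is an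
  element over \<open>A\<close> whose image is \<open>Dy\<close>.  This does not depend on \<open>D\<close> and \<open>x\<close>, since elements over
  \<open>A\<close> with the same image differ by a torsion element, on which \<open>\<psi>\<close> vanishes.
\<close>

lemma localized_separating_linear_form:
  fixes rels :: "('x word \<Rightarrow>\<^sub>0 'k::field) set"
  assumes loc: "is_localization A R" and rels: "rels \<subseteq> carrier (free_algebra A)"
    and free: "free_of_rank A (presented_algebra A rels) n"
    and y: "y \<in> carrier (presented_algebra R rels)" "y \<noteq> \<zero>\<^bsub>presented_algebra R rels\<^esub>"
  shows "\<exists>\<phi>. linear_form R (presented_algebra R rels) \<phi> \<and> \<phi> y \<noteq> 0"
proof -
  have A: "subring A ring_of_type_algebra" and R: "subring R ring_of_type_algebra" and AR: "A \<subseteq> R"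
    using loc by (auto simp: is_localization_def)
  interpret A: presentation A rels by (rule presentation.intro[OF A rels])
  interpret R: presentation R rels by (rule presentation.intro[OF R]) (use rels AR in auto)
  note [simp del] = free_algebra_simps(1)
  have FAR: "x \<in> R.F" if "x \<in> A.F" for x using that AR by (auto simp: free_algebra_simps(1))
  have den: "\<exists>D x. D \<in> denominators A R \<and> x \<in> A.F \<and> D \<odot>\<^bsub>R.M\<^esub> z = R.cls x" if "z \<in> carrier R.M" for z
    using presented_denominators[OF loc rels that] unfolding R.cls_def by blast
  have ker: "\<exists>D\<in>denominators A R. D \<odot>\<^bsub>A.M\<^esub> A.cls x = \<zero>\<^bsub>A.M\<^esub>"
    if "x \<in> A.F" "R.cls x = \<zero>\<^bsub>R.M\<^esub>" for x
    using presented_kernel[OF loc rels that(1)] that(2) unfolding R.cls_def A.cls_def by blast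
  have dA: "D \<in> A" "D \<in> R" "D \<noteq> 0" "inverse D \<in> R" if "D \<in> denominators A R" for D
    using that AR by (auto simp: denominators_def)
  obtain D0 x0 where 0: "D0 \<in> denominators A R" "x0 \<in> A.F" "D0 \<odot>\<^bsub>R.M\<^esub> y = R.cls x0"
    using den[OF y(1)] by blast
  have IAR: "A.I \<subseteq> R.I"
  proof -
    have "A.I \<subseteq> R.I \<inter> A.F"
      by (rule A.I_minimal) (use A.rels_carrier R.rels_I FAR in \<open>auto intro: R.I_closed A.F_closed\<close>)
    then show ?thesis by blast
  qed
  have "A.cls x0 \<noteq> \<zero>\<^bsub>A.M\<^esub>"
  proof
    assume "A.cls x0 = \<zero>\<^bsub>A.M\<^esub>"
    then have "D0 \<odot>\<^bsub>R.M\<^esub> y = \<zero>\<^bsub>R.M\<^esub>"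
      using 0 IAR FAR by (auto simp: A.cls_eq_zero_iff R.cls_eq_zero_iff)
    then have "inverse D0 \<odot>\<^bsub>R.M\<^esub> (D0 \<odot>\<^bsub>R.M\<^esub> y) = \<zero>\<^bsub>R.M\<^esub>"
      using dA[OF 0(1)] by (simp add: R.smult_conv_mult R.cls_closed R.F_closed)
    then have "1 \<odot>\<^bsub>R.M\<^esub> y = \<zero>\<^bsub>R.M\<^esub>" using dA[OF 0(1)] y(1) by (simp add: R.smult_smult)
    then show False using y R.C_closed(1) by (auto simp: R.smult_conv_mult R.M_simps(3)[symmetric])
  qed
  then obtain \<psi> where \<psi>: "linear_form A A.M \<psi>" and nz: "\<psi> (A.cls x0) \<noteq> 0"
    using A.free_separating_linear_form[OF free A.cls_closed[OF 0(2)]] by blast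
  have \<psi>C: "\<psi> x \<in> A" if "x \<in> carrier A.M" for x using \<psi> that by (auto simp: linear_form_def)
  have \<psi>add: "\<psi> (A.cls (x + z)) = \<psi> (A.cls x) + \<psi> (A.cls z)" if "x \<in> A.F" "z \<in> A.F" for x z
    using \<psi> that unfolding linear_form_def by (metis A.M_simps(1) A.cls_closed)
  have \<psi>mult: "\<psi> (A.cls (scalar k * x)) = k * \<psi> (A.cls x)" if "k \<in> A" "x \<in> A.F" for x k
    using \<psi> that unfolding linear_form_def by (metis A.M_simps(5) A.cls_closed)
  have \<psi>0: "\<psi> (A.cls x) = 0" if x: "x \<in> A.F" and x0: "R.cls x = \<zero>\<^bsub>R.M\<^esub>" for x
  proof -
    obtain E where E: "E \<in> denominators A R" "E \<odot>\<^bsub>A.M\<^esub> A.cls x = \<zero>\<^bsub>A.M\<^esub>" using ker[OF x x0] by blast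
    have "E * \<psi> (A.cls x) = 0"
      using \<psi>mult[of E x] A.linear_form_zero[OF \<psi>] E dA[OF E(1)] x by (simp add: A.M_simps(5))
    with dA[OF E(1)] show ?thesis by simp
  qed
  define \<phi> where "\<phi> z = (THE v. \<exists>D x. D \<in> denominators A R \<and> x \<in> A.F \<and> D \<odot>\<^bsub>R.M\<^esub> z = R.cls x
                         \<and> v = inverse D * \<psi> (A.cls x))" for z
  have \<phi>: "\<phi> z = inverse D * \<psi> (A.cls x)"
    if z: "z \<in> carrier R.M" and D: "D \<in> denominators A R" "x \<in> A.F" "D \<odot>\<^bsub>R.M\<^esub> z = R.cls x" for z D x
    unfolding \<phi>_def
  proof (rule the_equality)
    show "\<exists>E w. E \<in> denominators A R \<and> w \<in> A.F \<and> E \<odot>\<^bsub>R.M\<^esub> z = R.cls w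
        \<and> inverse D * \<psi> (A.cls x) = inverse E * \<psi> (A.cls w)"
      using D by blast
  next
    fix v assume "\<exists>E w. E \<in> denominators A R \<and> w \<in> A.F \<and> E \<odot>\<^bsub>R.M\<^esub> z = R.cls w \<and> v = inverse E * \<psi> (A.cls w)"
    then obtain E w where E: "E \<in> denominators A R" "w \<in> A.F" "E \<odot>\<^bsub>R.M\<^esub> z = R.cls w"
      and v: "v = inverse E * \<psi> (A.cls w)" by blast
    note dD = dA[OF D(1)] and dE = dA[OF E(1)]
    have "R.cls (scalar E * x) = E \<odot>\<^bsub>R.M\<^esub> (D \<odot>\<^bsub>R.M\<^esub> z)"
      using D(2) dE by (simp add: D(3) R.M_simps FAR)
    also have "\<dots> = D \<odot>\<^bsub>R.M\<^esub> (E \<odot>\<^bsub>R.M\<^esub> z)" using dE dD z by (simp add: R.smult_smult mult.commute)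
    also have "\<dots> = R.cls (scalar D * w)" using E(2) dD by (simp add: E(3) R.M_simps FAR)
    finally have eq: "R.cls (scalar E * x) = R.cls (scalar D * w)" .
    have mem: "scalar E * x \<in> A.F" "scalar D * w \<in> A.F" using D E dD dE by (auto intro: A.F_closed)
    have "R.cls (scalar E * x - scalar D * w) = \<zero>\<^bsub>R.M\<^esub>"
      using eq mem by (simp add: R.cls_eq_iff R.cls_eq_zero_iff FAR R.F_closed)
    from \<psi>0[OF A.F_closed(6)[OF mem] this]
    have "\<psi> (A.cls (scalar E * x - scalar D * w)) = 0" .
    moreover have "\<psi> (A.cls (scalar E * x)) = \<psi> (A.cls (scalar E * x - scalar D * w)) + \<psi> (A.cls (scalar D * w))"
      using \<psi>add[OF A.F_closed(6)[OF mem] mem(2)] by simp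
    ultimately have "E * \<psi> (A.cls x) = D * \<psi> (A.cls w)" using \<psi>mult dD dE D E by simp
    then show "v = inverse D * \<psi> (A.cls x)" using dD dE by (simp add: v field_simps)
  qed
  have "linear_form R R.M \<phi>"
    unfolding linear_form_def
  proof (intro conjI ballI)
    show "\<phi> \<in> carrier R.M \<rightarrow> R"
    proof
      fix z assume z: "z \<in> carrier R.M"
      obtain D x where D: "D \<in> denominators A R" "x \<in> A.F" "D \<odot>\<^bsub>R.M\<^esub> z = R.cls x" using den[OF z] by blast
      show "\<phi> z \<in> R" unfolding \<phi>[OF z D]
        using dA[OF D(1)] \<psi>C[OF A.cls_closed[OF D(2)]] AR by (auto intro: R.C_closed)
    qed
  next
    fix z w assume z: "z \<in> carrier R.M" and w: "w \<in> carrier R.M"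
    obtain D x where D: "D \<in> denominators A R" "x \<in> A.F" "D \<odot>\<^bsub>R.M\<^esub> z = R.cls x" using den[OF z] by blast
    obtain E v where E: "E \<in> denominators A R" "v \<in> A.F" "E \<odot>\<^bsub>R.M\<^esub> w = R.cls v" using den[OF w] by blast
    note dD = dA[OF D(1)] and dE = dA[OF E(1)]
    have DE: "D * E \<in> denominators A R" using D(1) E(1) A.C_closed R.C_closed by (auto simp: denominators_def)
    have "(D * E) \<odot>\<^bsub>R.M\<^esub> (z \<oplus>\<^bsub>R.M\<^esub> w) = E \<odot>\<^bsub>R.M\<^esub> (D \<odot>\<^bsub>R.M\<^esub> z) \<oplus>\<^bsub>R.M\<^esub> D \<odot>\<^bsub>R.M\<^esub> (E \<odot>\<^bsub>R.M\<^esub> w)"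
      using dD dE z w by (simp add: R.smult_smult R.smult_add_right R.C_closed mult.commute)
    also have "\<dots> = R.cls (scalar E * x + scalar D * v)"
      using dD dE D E by (simp add: R.M_simps FAR R.F_closed)
    finally have *: "(D * E) \<odot>\<^bsub>R.M\<^esub> (z \<oplus>\<^bsub>R.M\<^esub> w) = R.cls (scalar E * x + scalar D * v)" .
    have mem: "scalar E * x \<in> A.F" "scalar D * v \<in> A.F" using D E dD dE by (auto intro: A.F_closed)
    have "\<phi> (z \<oplus>\<^bsub>R.M\<^esub> w) = inverse (D * E) * \<psi> (A.cls (scalar E * x + scalar D * v))"
      by (rule \<phi>[OF _ DE _ *]) (use z w mem in \<open>auto intro: A.F_closed\<close>)
    also have "\<dots> = inverse D * \<psi> (A.cls x) + inverse E * \<psi> (A.cls v)"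
      using dD dE D E mem by (simp add: \<psi>add \<psi>mult field_simps)
    finally show "\<phi> (z \<oplus>\<^bsub>R.M\<^esub> w) = \<phi> z + \<phi> w" using \<phi>[OF z D] \<phi>[OF w E] by simp
  next
    fix k z assume k: "k \<in> R" and z: "z \<in> carrier R.M"
    obtain D x where D: "D \<in> denominators A R" "x \<in> A.F" "D \<odot>\<^bsub>R.M\<^esub> z = R.cls x" using den[OF z] by blast
    obtain E where E: "E \<in> denominators A R" "E * k \<in> A"
      using loc k by (auto simp: is_localization_def denominators_def)
    note dD = dA[OF D(1)] and dE = dA[OF E(1)]
    have DE: "D * E \<in> denominators A R" using D(1) E(1) A.C_closed R.C_closed by (auto simp: denominators_def)
    have "(D * E) \<odot>\<^bsub>R.M\<^esub> (k \<odot>\<^bsub>R.M\<^esub> z) = (E * k) \<odot>\<^bsub>R.M\<^esub> (D \<odot>\<^bsub>R.M\<^esub> z)"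
      using dD dE k z by (simp add: R.smult_smult R.C_closed mult_ac)
    also have "\<dots> = R.cls (scalar (E * k) * x)"
      using dE k D by (simp add: R.M_simps FAR R.C_closed)
    finally have *: "(D * E) \<odot>\<^bsub>R.M\<^esub> (k \<odot>\<^bsub>R.M\<^esub> z) = R.cls (scalar (E * k) * x)" .
    have "\<phi> (k \<odot>\<^bsub>R.M\<^esub> z) = inverse (D * E) * \<psi> (A.cls (scalar (E * k) * x))"
      by (rule \<phi>[OF _ DE _ *]) (use z k D E in \<open>auto intro: A.F_closed R.smult_closed\<close>)
    also have "\<dots> = k * (inverse D * \<psi> (A.cls x))"
      using dD dE D E by (simp add: \<psi>mult field_simps)
    finally show "\<phi> (k \<odot>\<^bsub>R.M\<^esub> z) = k * \<phi> z" using \<phi>[OF z D] by simp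
  qed
  moreover have "\<phi> y \<noteq> 0" using \<phi>[OF y(1) 0] nz dA[OF 0(1)] by simp
  ultimately show ?thesis by blast
qed

section \<open>The twist by a root of unity\<close>

definition u_degree :: "gen word \<Rightarrow> nat" where
  "u_degree w = count_list (letters w) u_gen"

lemma u_degree_simps [simp]:
  "u_degree 0 = 0" "u_degree (v + w) = u_degree v + u_degree w"
  "u_degree (Word (g # gs)) = (if g = u_gen then 1 else 0) + u_degree (Word gs)" "u_degree (Word []) = 0"
  by (simp_all add: u_degree_def zero_word_def plus_word_def)

text \<open>
  The endomorphism of the free algebra that fixes \<open>s\<close> and \<open>t\<close> and maps \<open>u\<close> to \<open>cu\<close>.
\<close>

definition twist :: "'k::field \<Rightarrow> (gen word \<Rightarrow>\<^sub>0 'k) \<Rightarrow> gen word \<Rightarrow>\<^sub>0 'k" where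
  "twist c = Poly_Mapping.mapp (\<lambda>w a. c ^ u_degree w * a)"

lemma lookup_twist: "Poly_Mapping.lookup (twist c f) w = c ^ u_degree w * Poly_Mapping.lookup f w"
  by (simp add: twist_def lookup_mapp when_def in_keys_iff)

lemma twist_single: "twist c (Poly_Mapping.single w a) = Poly_Mapping.single w (c ^ u_degree w * a)"
  by (rule poly_mapping_eqI) (simp add: lookup_twist lookup_single when_def)

lemma twist_add: "twist c (f + g) = twist c f + twist c g"
  and twist_minus: "twist c (- f) = - twist c f"
  and twist_diff: "twist c (f - g) = twist c f - twist c g"
  and twist_zero: "twist c 0 = 0"
  and twist_twist: "twist c (twist e f) = twist (c * e) f"
  and twist_by_one: "twist 1 f = f"
  by (rule poly_mapping_eqI, simp add: lookup_twist lookup_add lookup_minus algebra_simps power_mult_distrib)+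

lemma twist_sum: "twist c (sum f J) = (\<Sum>i\<in>J. twist c (f i))"
  by (induction J rule: infinite_finite_induct) (simp_all add: twist_add twist_zero)

lemma sum_monomials: "f = (\<Sum>w\<in>Poly_Mapping.keys f. Poly_Mapping.single w (Poly_Mapping.lookup f w))"
  for f :: "'x \<Rightarrow>\<^sub>0 'k::comm_monoid_add"
  by (rule poly_mapping_eqI)
     (simp add: lookup_sum lookup_single when_def sum.delta in_keys_iff)

lemma twist_mult: "twist c (f * g) = twist c f * twist c g"
proof -
  define S where "S = (\<lambda>f w. Poly_Mapping.single (w :: gen word) (Poly_Mapping.lookup f w :: 'a))"
  have S: "f = sum (S f) (Poly_Mapping.keys f)" for f unfolding S_def by (rule sum_monomials)
  have "f * g = (\<Sum>v\<in>Poly_Mapping.keys f. \<Sum>w\<in>Poly_Mapping.keys g. S f v * S g w)"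
    by (subst S[of f], subst S[of g]) (simp only: sum_product)
  then have "twist c (f * g) = (\<Sum>v\<in>Poly_Mapping.keys f. \<Sum>w\<in>Poly_Mapping.keys g. twist c (S f v * S g w))"
    by (simp only: twist_sum)
  also have "\<dots> = (\<Sum>v\<in>Poly_Mapping.keys f. \<Sum>w\<in>Poly_Mapping.keys g. twist c (S f v) * twist c (S g w))"
    by (intro sum.cong refl) (simp add: S_def twist_single mult_single power_add mult_ac)
  also have "\<dots> = twist c (sum (S f) (Poly_Mapping.keys f)) * twist c (sum (S g) (Poly_Mapping.keys g))"
    by (simp only: twist_sum sum_product)
  also have "\<dots> = twist c f * twist c g" by (simp only: S[symmetric])
  finally show ?thesis .
qed

lemma twist_scalar: "twist c (scalar a) = scalar a"
  and twist_one: "twist c 1 = 1"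
  and twist_letter: "twist c (letter g) = scalar (if g = u_gen then c else 1) * letter g"
  by (simp_all add: scalar_def letter_def twist_single mult_single flip: single_one)

definition u_degree_zero_part :: "nat \<Rightarrow> (gen word \<Rightarrow>\<^sub>0 'k::field) \<Rightarrow> gen word \<Rightarrow>\<^sub>0 'k" where
  "u_degree_zero_part p = Poly_Mapping.mapp (\<lambda>w a. if p dvd u_degree w then a else 0)"

lemma lookup_u_degree_zero_part:
  "Poly_Mapping.lookup (u_degree_zero_part p f) w = (if p dvd u_degree w then Poly_Mapping.lookup f w else 0)"
  by (simp add: u_degree_zero_part_def lookup_mapp when_def in_keys_iff)

text \<open>
  Averaging over all \<open>p\<close>-th roots of unity projects to degree zero, since the powers of a root of
  unity other than \<open>1\<close> add up to zero.
\<close>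

lemma sum_twist:
  assumes om: "\<omega> ^ p = 1" and prim: "\<And>j. \<omega> ^ j = 1 \<Longrightarrow> p dvd j"
  shows "(\<Sum>j<p. twist (\<omega> ^ j) f) = scalar (of_nat p) * u_degree_zero_part p f"
proof (rule poly_mapping_eqI)
  fix w
  define k where "k = u_degree w"
  have "(\<Sum>j<p. (\<omega> ^ j) ^ k) = (if p dvd k then of_nat p else 0)"
  proof (cases "p dvd k")
    case True
    then have "\<omega> ^ k = 1" using om by (auto simp: power_mult)
    then have "(\<omega> ^ j) ^ k = 1" for j by (metis power_commutes power_mult mult.commute power_one)
    then show ?thesis using True by simp
  next
    case False
    then have "\<omega> ^ k \<noteq> 1" using prim by blast
    moreover have "(\<Sum>j<p. (\<omega> ^ j) ^ k) = (\<Sum>j<p. (\<omega> ^ k) ^ j)"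
      by (simp add: mult.commute flip: power_mult)
    moreover have "(\<omega> ^ k) ^ p = 1" using om by (metis power_mult mult.commute power_one)
    ultimately show ?thesis using False by (simp add: geometric_sum)
  qed
  then show "Poly_Mapping.lookup (\<Sum>j<p. twist (\<omega> ^ j) f) w =
      Poly_Mapping.lookup (scalar (of_nat p) * u_degree_zero_part p f) w"
    by (simp add: lookup_sum lookup_twist scalar_mult_lookup lookup_u_degree_zero_part k_def
        flip: sum_distrib_right)
qed


section \<open>Central idempotents\<close>

lemma block_idempotents_cong:
  assumes "\<And>e. e \<otimes>\<^bsub>R\<^esub> e = e \<Longrightarrow> e \<in> ring_center (R\<lparr>carrier := K\<rparr>) \<longleftrightarrow> e \<in> ring_center R"
  shows "block_idempotents (R\<lparr>carrier := K\<rparr>) = block_idempotents R"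
proof -
  have "idempotents (R\<lparr>carrier := ring_center (R\<lparr>carrier := K\<rparr>)\<rparr>) = idempotents (R\<lparr>carrier := ring_center R\<rparr>)"
    using assms by (auto simp: idempotents_def)
  then show ?thesis by (simp add: block_idempotents_def primitive_idempotents_def)
qed

lemma (in ring) idempotent_mult:
  assumes "e \<in> carrier R" "f \<in> carrier R" "e \<otimes> e = e" "f \<otimes> f = f" "e \<otimes> f = f \<otimes> e"
  shows "(e \<otimes> f) \<otimes> (e \<otimes> f) = e \<otimes> f"
proof -
  have "(e \<otimes> f) \<otimes> (e \<otimes> f) = e \<otimes> (f \<otimes> e) \<otimes> f" using assms(1,2) by (simp add: m_assoc)
  also have "\<dots> = (e \<otimes> e) \<otimes> (f \<otimes> f)" using assms(1,2) by (simp add: assms(5)[symmetric] m_assoc)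
  finally show ?thesis using assms(3,4) by simp
qed

lemma (in ring) idempotent_compl:
  assumes "f \<in> carrier R" "f \<otimes> f = f"
  shows "(\<one> \<ominus> f) \<otimes> (\<one> \<ominus> f) = \<one> \<ominus> f"
  using assms by (simp add: a_minus_def l_distr r_distr l_minus r_minus r_neg)

text \<open>Here \<open>aeu = eau = aue\<close>, and \<open>a\<close> can be cancelled.\<close>

lemma (in ring) commute_cofactor:
  assumes c: "a \<in> carrier R" "b \<in> carrier R" "u \<in> carrier R" "e \<in> carrier R"
    and inv: "b \<otimes> a = \<one>" and ea: "e \<otimes> a = a \<otimes> e" and z: "e \<otimes> (a \<otimes> u) = (a \<otimes> u) \<otimes> e"
  shows "e \<otimes> u = u \<otimes> e"
proof -
  have "a \<otimes> (e \<otimes> u) = e \<otimes> (a \<otimes> u)" using c by (simp add: ea m_assoc[symmetric])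
  also have "\<dots> = a \<otimes> (u \<otimes> e)" using c by (simp add: z m_assoc)
  finally have "b \<otimes> (a \<otimes> (e \<otimes> u)) = b \<otimes> (a \<otimes> (u \<otimes> e))" by simp
  then have "(b \<otimes> a) \<otimes> (e \<otimes> u) = (b \<otimes> a) \<otimes> (u \<otimes> e)" using c by (simp add: m_assoc)
  then show ?thesis using c inv by simp
qed

text \<open>
  What the argument uses of the Hecke algebra: the braid relations, invertible parameters of \<open>s\<close> and
  \<open>t\<close>, a primitive \<open>p\<close>-th root of unity whose twist respects the ideal of relations, faithful linear
  forms in place of freeness, and separatedness of the coefficient ring for the \<open>(1 - \<omega>\<^sup>j)\<close>-adic
  topology if \<open>\<omega>\<^sup>j\<close> has prime power order.
\<close>

locale braid_presentation = presentation C rels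
  for C :: "'k::field set" and rels :: "(gen word \<Rightarrow>\<^sub>0 'k) set" +
  fixes p :: nat and \<alpha> \<alpha>' \<beta> \<beta>' \<omega> :: 'k
  assumes p: "p \<ge> 1" "of_nat p \<noteq> (0 :: 'k)"
    and braid: "letter s_gen * letter t_gen * letter u_gen - letter t_gen * letter u_gen * letter s_gen \<in> rels"
      "letter t_gen * letter u_gen * letter s_gen - letter u_gen * letter s_gen * letter t_gen \<in> rels"
    and quadratic: "(letter s_gen - scalar \<alpha>) * (letter s_gen + scalar \<alpha>') \<in> rels"
      "(letter t_gen - scalar \<beta>) * (letter t_gen + scalar \<beta>') \<in> rels"
    and units: "\<alpha> \<in> C" "\<alpha>' \<in> C" "\<beta> \<in> C" "\<beta>' \<in> C" "\<alpha> \<noteq> 0" "\<alpha>' \<noteq> 0" "\<beta> \<noteq> 0" "\<beta>' \<noteq> 0"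
      "inverse \<alpha> \<in> C" "inverse \<alpha>' \<in> C" "inverse \<beta> \<in> C" "inverse \<beta>' \<in> C"
    and omega: "\<omega> \<in> C" "\<omega> ^ p = 1" "\<And>j. \<omega> ^ j = 1 \<Longrightarrow> p dvd j"
    and homogeneous: "\<And>r. r \<in> rels \<Longrightarrow> twist \<omega> r \<in> Idl\<^bsub>free_algebra C\<^esub> rels"
    and faithful: "\<And>y. y \<in> carrier (presented_algebra C rels) \<Longrightarrow> y \<noteq> \<zero>\<^bsub>presented_algebra C rels\<^esub> \<Longrightarrow>
          \<exists>\<phi>. linear_form C (presented_algebra C rels) \<phi> \<and> \<phi> y \<noteq> 0"
    and separated: "\<And>l a j r. prime l \<Longrightarrow> (\<omega> ^ j) ^ (l ^ a) = 1 \<Longrightarrow> r \<in> C \<Longrightarrow>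
          (\<And>k. \<exists>y\<in>C. r = (1 - \<omega> ^ j) ^ k * y) \<Longrightarrow> r = 0"
begin

declare free_algebra_simps(1) [simp del]

abbreviation s where "s \<equiv> cls (letter s_gen)"
abbreviation t where "t \<equiv> cls (letter t_gen)"
abbreviation u where "u \<equiv> cls (letter u_gen)"

abbreviation z where "z \<equiv> s \<otimes>\<^bsub>M\<^esub> t \<otimes>\<^bsub>M\<^esub> u"

lemma stu_closed: "s \<in> carrier M" "t \<in> carrier M" "u \<in> carrier M"
  by (simp_all add: cls_closed letter_F)

lemma stu_cyclic: "z = t \<otimes>\<^bsub>M\<^esub> u \<otimes>\<^bsub>M\<^esub> s" "t \<otimes>\<^bsub>M\<^esub> u \<otimes>\<^bsub>M\<^esub> s = u \<otimes>\<^bsub>M\<^esub> s \<otimes>\<^bsub>M\<^esub> t"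
  using braid rels_I by (auto simp: M_simps F_closed letter_F cls_eq_iff)

lemma C_power: "c \<in> C \<Longrightarrow> c ^ n \<in> C"
  by (induction n) (simp_all add: C_closed)

lemma monomial_F: "c \<in> C \<Longrightarrow> Poly_Mapping.single w c \<in> F"
  using C_closed(2) by (auto simp: free_algebra_simps(1) lookup_single when_def)

lemma single_Word_Cons: "Poly_Mapping.single (Word (g # gs)) c = letter g * Poly_Mapping.single (Word gs) c"
  by (simp add: letter_def mult_single plus_word_def)

lemma cls_in_subring:
  assumes K: "subring K M" and x: "x \<in> F"
    and mono: "\<And>w. w \<in> Poly_Mapping.keys x \<Longrightarrow> cls (Poly_Mapping.single w (Poly_Mapping.lookup x w)) \<in> K"
  shows "cls x \<in> K"
proof -
  have lk: "Poly_Mapping.lookup x w \<in> C" for w using x by (simp add: free_algebra_simps(1))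
  have "cls (\<Sum>w\<in>W. Poly_Mapping.single w (Poly_Mapping.lookup x w)) \<in> K"
    if "finite W" "W \<subseteq> Poly_Mapping.keys x" for W
    using that
  proof (induction W rule: finite_induct)
    case empty
    then show ?case using subringE(2)[OF K] by (simp add: M_simps)
  next
    case (insert w W)
    then show ?case
      using subringE(7)[OF K mono[of w], of "cls (\<Sum>w\<in>W. Poly_Mapping.single w (Poly_Mapping.lookup x w))"]
      by (simp add: M_simps monomial_F lk F_sum)
  qed
  from this[of "Poly_Mapping.keys x"] show ?thesis by (simp flip: sum_monomials)
qed

lemma subring_centralizer:
  assumes e: "e \<in> carrier M"
  shows "subring {x \<in> carrier M. x \<otimes>\<^bsub>M\<^esub> e = e \<otimes>\<^bsub>M\<^esub> x} M"
proof (rule M.subringI)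
  fix x y assume xy: "x \<in> {x \<in> carrier M. x \<otimes>\<^bsub>M\<^esub> e = e \<otimes>\<^bsub>M\<^esub> x}" "y \<in> {x \<in> carrier M. x \<otimes>\<^bsub>M\<^esub> e = e \<otimes>\<^bsub>M\<^esub> x}"
  have "x \<otimes>\<^bsub>M\<^esub> y \<otimes>\<^bsub>M\<^esub> e = x \<otimes>\<^bsub>M\<^esub> (e \<otimes>\<^bsub>M\<^esub> y)" using xy e by (simp add: M.m_assoc)
  also have "\<dots> = e \<otimes>\<^bsub>M\<^esub> (x \<otimes>\<^bsub>M\<^esub> y)" using xy e by (simp add: M.m_assoc[symmetric])
  finally show "x \<otimes>\<^bsub>M\<^esub> y \<in> {x \<in> carrier M. x \<otimes>\<^bsub>M\<^esub> e = e \<otimes>\<^bsub>M\<^esub> x}" using xy by simp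
  show "x \<oplus>\<^bsub>M\<^esub> y \<in> {x \<in> carrier M. x \<otimes>\<^bsub>M\<^esub> e = e \<otimes>\<^bsub>M\<^esub> x}"
    using xy e by (simp add: M.l_distr M.r_distr)
qed (use e in \<open>auto simp: M.l_minus M.r_minus\<close>)

lemma centralI:
  assumes e: "e \<in> carrier M" and g: "\<And>g. cls (letter g) \<otimes>\<^bsub>M\<^esub> e = e \<otimes>\<^bsub>M\<^esub> cls (letter g)"
    and x: "x \<in> carrier M"
  shows "x \<otimes>\<^bsub>M\<^esub> e = e \<otimes>\<^bsub>M\<^esub> x"
proof -
  let ?Z = "{x \<in> carrier M. x \<otimes>\<^bsub>M\<^esub> e = e \<otimes>\<^bsub>M\<^esub> x}"
  note Z = subring_centralizer[OF e]
  have "cls (Poly_Mapping.single w c) \<in> ?Z" if "c \<in> C" for w c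
  proof (cases w)
    case (Word gs)
    show ?thesis unfolding Word
    proof (induction gs)
      case Nil
      have "Poly_Mapping.single (Word [] :: gen word) c = scalar c" by (simp add: scalar_def zero_word_def)
      then show ?case using scalar_commute[OF that e] that by (simp add: cls_closed F_closed)
    next
      case (Cons g gs)
      have "cls (letter g) \<in> ?Z" using g by (simp add: cls_closed letter_F)
      from subringE(6)[OF Z this Cons] show ?case
        by (simp add: single_Word_Cons M_simps letter_F monomial_F that)
    qed
  qed
  note mono = this
  obtain y where y: "y \<in> F" "x = cls y" using x unfolding carrier_M by (rule imageE)
  have lk: "Poly_Mapping.lookup y w \<in> C" for w using y(1) by (simp add: free_algebra_simps(1))
  have "cls y \<in> ?Z" by (rule cls_in_subring[OF Z y(1)]) (rule mono[OF lk])
  then show ?thesis using y by simp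
qed

lemma z_closed: "z \<in> carrier M"
  using stu_closed by simp

lemma z_central: "x \<in> carrier M \<Longrightarrow> x \<otimes>\<^bsub>M\<^esub> z = z \<otimes>\<^bsub>M\<^esub> x"
proof (rule centralI[OF z_closed])
  fix g
  have "s \<otimes>\<^bsub>M\<^esub> z = z \<otimes>\<^bsub>M\<^esub> s"
    by (subst stu_cyclic(1)) (use stu_closed in \<open>simp add: M.m_assoc\<close>)
  moreover have "u \<otimes>\<^bsub>M\<^esub> z = z \<otimes>\<^bsub>M\<^esub> u"
    by (subst (2) stu_cyclic(1), subst stu_cyclic(2)) (use stu_closed in \<open>simp add: M.m_assoc\<close>)
  moreover have "t \<otimes>\<^bsub>M\<^esub> z = z \<otimes>\<^bsub>M\<^esub> t"
    by (subst (2) stu_cyclic(1), subst (1) stu_cyclic(1), subst stu_cyclic(2))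
       (use stu_closed in \<open>simp add: M.m_assoc\<close>)
  ultimately show "cls (letter g) \<otimes>\<^bsub>M\<^esub> z = z \<otimes>\<^bsub>M\<^esub> cls (letter g)" by (cases g) simp_all
qed

text \<open>
  A relation \<open>(g - a)(g + b) = 0\<close> reads \<open>(g + b - a)g = ab\<close>.
\<close>

lemma quadratic_inverse:
  assumes rel: "(letter g - scalar a) * (letter g + scalar b) \<in> rels"
    and ab: "a \<in> C" "b \<in> C" "a \<noteq> 0" "b \<noteq> 0" "inverse a \<in> C" "inverse b \<in> C"
  defines "v \<equiv> scalar (inverse a * inverse b) * (letter g + scalar (b - a))"
  shows "cls v \<otimes>\<^bsub>M\<^esub> cls (letter g) = \<one>\<^bsub>M\<^esub>"
proof -
  have sd: "scalar (b - a) = (scalar b - scalar a :: gen word \<Rightarrow>\<^sub>0 'k)" by (simp add: scalar_def single_diff)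
  have "(letter g + scalar (b - a)) * letter g - scalar (a * b) = (letter g - scalar a) * (letter g + scalar b)"
    by (simp add: sd scalar_mult algebra_simps scalar_central[of b "letter g"])
  then have "scalar (inverse a * inverse b) * ((letter g + scalar (b - a)) * letter g - scalar (a * b)) \<in> I"
    using rel rels_I ab by (intro I_closed(6)) (auto intro: F_closed C_closed)
  moreover have "scalar (inverse a * inverse b) * scalar (a * b) = (1 :: gen word \<Rightarrow>\<^sub>0 'k)"
  proof -
    have "inverse a * inverse b * (a * b) = 1" using ab by (simp add: field_simps)
    then show ?thesis unfolding scalar_mult[symmetric] by simp
  qed
  ultimately have "v * letter g - 1 \<in> I" by (simp add: v_def right_diff_distrib mult.assoc)
  moreover have "v \<in> F" using ab by (auto simp: v_def intro!: F_closed C_closed letter_F)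
  ultimately show ?thesis by (simp add: M_simps letter_F F_closed cls_eq_iff)
qed

section \<open>The subalgebra and the part of degree zero\<close>

definition K where
  "K = generate_ring M ({c \<odot>\<^bsub>M\<^esub> \<one>\<^bsub>M\<^esub> | c. c \<in> C} \<union> {s, t, u [^]\<^bsub>M\<^esub> p})"

lemma K_gens: "{c \<odot>\<^bsub>M\<^esub> \<one>\<^bsub>M\<^esub> | c. c \<in> C} \<union> {s, t, u [^]\<^bsub>M\<^esub> p} \<subseteq> carrier M"
  using stu_closed smult_closed by auto

lemma subring_K: "subring K M"
  unfolding K_def by (rule M.generate_ring_is_subring[OF K_gens])

lemma K_carrier: "x \<in> K \<Longrightarrow> x \<in> carrier M"
  using subringE(1)[OF subring_K] by blast

lemma K_incl: "s \<in> K" "t \<in> K" "u [^]\<^bsub>M\<^esub> p \<in> K" "c \<in> C \<Longrightarrow> cls (scalar c) \<in> K"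
proof -
  show "s \<in> K" "t \<in> K" "u [^]\<^bsub>M\<^esub> p \<in> K" unfolding K_def by (rule generate_ring.incl, simp)+
  assume "c \<in> C"
  then have "c \<odot>\<^bsub>M\<^esub> \<one>\<^bsub>M\<^esub> \<in> K"
    unfolding K_def by (intro generate_ring.incl) blast
  with \<open>c \<in> C\<close> show "cls (scalar c) \<in> K" by (simp add: smult_conv_mult cls_closed F_closed)
qed

lemma st_inverse: obtains b where "b \<in> K" "b \<otimes>\<^bsub>M\<^esub> (s \<otimes>\<^bsub>M\<^esub> t) = \<one>\<^bsub>M\<^esub>"
proof -
  have K: "cls (scalar c * (letter g + scalar e)) \<in> K" if "c \<in> C" "e \<in> C" "cls (letter g) \<in> K" for c e g
  proof -
    have "cls (scalar c * (letter g + scalar e)) = cls (scalar c) \<otimes>\<^bsub>M\<^esub> (cls (letter g) \<oplus>\<^bsub>M\<^esub> cls (scalar e))"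
      using that by (simp add: M_simps F_closed letter_F)
    then show ?thesis using subringE(6,7)[OF subring_K] K_incl(4) that by auto
  qed
  obtain a where a: "a \<in> K" "a \<otimes>\<^bsub>M\<^esub> s = \<one>\<^bsub>M\<^esub>"
    using quadratic_inverse[OF quadratic(1)] K[OF _ _ K_incl(1)] units C_closed by metis
  obtain b where b: "b \<in> K" "b \<otimes>\<^bsub>M\<^esub> t = \<one>\<^bsub>M\<^esub>"
    using quadratic_inverse[OF quadratic(2)] K[OF _ _ K_incl(2)] units C_closed by metis
  note c = stu_closed K_carrier[OF a(1)] K_carrier[OF b(1)]
  have "(b \<otimes>\<^bsub>M\<^esub> a) \<otimes>\<^bsub>M\<^esub> (s \<otimes>\<^bsub>M\<^esub> t) = b \<otimes>\<^bsub>M\<^esub> (a \<otimes>\<^bsub>M\<^esub> s) \<otimes>\<^bsub>M\<^esub> t" using c by (simp add: M.m_assoc)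
  also have "\<dots> = \<one>\<^bsub>M\<^esub>" using c a(2) b(2) by simp
  finally show ?thesis using that subringE(6)[OF subring_K b(1) a(1)] by blast
qed

text \<open>
  Since \<open>z = (st)u\<close> is central and \<open>st\<close> is a unit, conjugation by \<open>u\<close> is conjugation by the
  element \<open>(st)\<^sup>-\<^sup>1\<close> of \<open>K\<close>.
\<close>

lemma center_K_subset:
  assumes "e \<in> ring_center (M\<lparr>carrier := K\<rparr>)"
  shows "e \<in> ring_center M"
proof -
  have e: "e \<in> K" and comm: "\<And>x. x \<in> K \<Longrightarrow> x \<otimes>\<^bsub>M\<^esub> e = e \<otimes>\<^bsub>M\<^esub> x"
    using assms by (auto simp: ring_center_def)
  note eM = K_carrier[OF e]
  obtain b where b: "b \<in> K" "b \<otimes>\<^bsub>M\<^esub> (s \<otimes>\<^bsub>M\<^esub> t) = \<one>\<^bsub>M\<^esub>" by (rule st_inverse)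
  have "e \<otimes>\<^bsub>M\<^esub> u = u \<otimes>\<^bsub>M\<^esub> e"
    by (rule M.commute_cofactor[OF _ K_carrier[OF b(1)] _ eM b(2)])
       (use stu_closed z_central[OF eM] comm[OF subringE(6)[OF subring_K K_incl(1,2)]] in auto)
  then have "cls (letter g) \<otimes>\<^bsub>M\<^esub> e = e \<otimes>\<^bsub>M\<^esub> cls (letter g)" for g
    using comm K_incl by (cases g) auto
  then show ?thesis using centralI[OF eM] eM by (auto simp: ring_center_def)
qed

text \<open>
  Each letter \<open>u\<close> is replaced by \<open>(st)\<^sup>-\<^sup>1z\<close>, and the central factor \<open>z\<close> is moved to the right.
\<close>

lemma word_in_K_times_z_power:
  assumes "c \<in> C"
  shows "\<exists>k\<in>K. cls (Poly_Mapping.single (Word gs) c) = k \<otimes>\<^bsub>M\<^esub> z [^]\<^bsub>M\<^esub> u_degree (Word gs)"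
proof (induction gs)
  case Nil
  have "Poly_Mapping.single (Word [] :: gen word) c = scalar c" by (simp add: scalar_def zero_word_def)
  then show ?case using K_incl(4)[OF assms] K_carrier[OF K_incl(4)[OF assms]] by (intro bexI[of _ "cls (scalar c)"]) simp_all
next
  case (Cons g gs)
  then obtain k where k: "k \<in> K" "cls (Poly_Mapping.single (Word gs) c) = k \<otimes>\<^bsub>M\<^esub> z [^]\<^bsub>M\<^esub> u_degree (Word gs)"
    by blast
  note kM = K_carrier[OF k(1)]
  have eq: "cls (Poly_Mapping.single (Word (g # gs)) c) = cls (letter g) \<otimes>\<^bsub>M\<^esub> (k \<otimes>\<^bsub>M\<^esub> z [^]\<^bsub>M\<^esub> u_degree (Word gs))"
    unfolding k(2)[symmetric] by (simp add: single_Word_Cons M_simps letter_F monomial_F assms)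
  show ?case
  proof (cases "g = u_gen")
    case False
    then have g: "cls (letter g) \<in> K" using K_incl by (cases g) auto
    show ?thesis unfolding eq using False subringE(6)[OF subring_K g k(1)] K_carrier[OF g] kM z_closed
      by (intro bexI[of _ "cls (letter g) \<otimes>\<^bsub>M\<^esub> k"]) (simp_all add: M.m_assoc)
  next
    case True
    obtain b where b: "b \<in> K" "b \<otimes>\<^bsub>M\<^esub> (s \<otimes>\<^bsub>M\<^esub> t) = \<one>\<^bsub>M\<^esub>" by (rule st_inverse)
    note bM = K_carrier[OF b(1)]
    have "b \<otimes>\<^bsub>M\<^esub> z = (b \<otimes>\<^bsub>M\<^esub> (s \<otimes>\<^bsub>M\<^esub> t)) \<otimes>\<^bsub>M\<^esub> u" using stu_closed bM by (simp add: M.m_assoc)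
    then have u: "u = b \<otimes>\<^bsub>M\<^esub> z" using b(2) stu_closed by simp
    have "u \<otimes>\<^bsub>M\<^esub> (k \<otimes>\<^bsub>M\<^esub> z [^]\<^bsub>M\<^esub> u_degree (Word gs)) = b \<otimes>\<^bsub>M\<^esub> (z \<otimes>\<^bsub>M\<^esub> (k \<otimes>\<^bsub>M\<^esub> z [^]\<^bsub>M\<^esub> u_degree (Word gs)))"
      using bM kM z_closed M.m_assoc[OF bM z_closed] unfolding u[symmetric]
      by (metis M.m_closed M.nat_pow_closed u)
    also have "\<dots> = b \<otimes>\<^bsub>M\<^esub> (k \<otimes>\<^bsub>M\<^esub> z [^]\<^bsub>M\<^esub> u_degree (Word gs) \<otimes>\<^bsub>M\<^esub> z)"
      using z_central[of "k \<otimes>\<^bsub>M\<^esub> z [^]\<^bsub>M\<^esub> u_degree (Word gs)"] kM z_closed by simp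
    also have "\<dots> = (b \<otimes>\<^bsub>M\<^esub> k) \<otimes>\<^bsub>M\<^esub> z [^]\<^bsub>M\<^esub> u_degree (Word (g # gs))"
      using bM kM z_closed True by (simp add: M.m_assoc)
    finally show ?thesis unfolding eq using True subringE(6)[OF subring_K b(1) k(1)] by auto
  qed
qed

text \<open>
  Because \<open>st\<close> and \<open>u\<close> commute, \<open>z\<^sup>p = (st)\<^sup>p u\<^sup>p\<close>.
\<close>

lemma z_power_in_K: "p dvd n \<Longrightarrow> z [^]\<^bsub>M\<^esub> n \<in> K"
proof -
  have "(s \<otimes>\<^bsub>M\<^esub> t) \<otimes>\<^bsub>M\<^esub> u = u \<otimes>\<^bsub>M\<^esub> (s \<otimes>\<^bsub>M\<^esub> t)"
    using stu_cyclic stu_closed by (simp add: M.m_assoc)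
  then have "z [^]\<^bsub>M\<^esub> p = (s \<otimes>\<^bsub>M\<^esub> t) [^]\<^bsub>M\<^esub> p \<otimes>\<^bsub>M\<^esub> u [^]\<^bsub>M\<^esub> p"
    using stu_closed by (intro M.pow_mult_distrib) auto
  moreover have pow: "x [^]\<^bsub>M\<^esub> n \<in> K" if "x \<in> K" for x and n :: nat
    using that subringE(3,6)[OF subring_K] by (induction n) simp_all
  ultimately have "z [^]\<^bsub>M\<^esub> p \<in> K"
    using subringE(6)[OF subring_K] K_incl by simp
  then have "(z [^]\<^bsub>M\<^esub> p) [^]\<^bsub>M\<^esub> m \<in> K" for m :: nat by (rule pow)
  moreover assume "p dvd n"
  ultimately show ?thesis using z_closed by (auto simp: M.nat_pow_pow)
qed

lemma u_degree_zero_in_K: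
  assumes x: "x \<in> F" shows "cls (u_degree_zero_part p x) \<in> K"
proof (rule cls_in_subring[OF subring_K])
  show F: "u_degree_zero_part p x \<in> F"
    using x C_closed(2) by (simp add: free_algebra_simps(1) lookup_u_degree_zero_part)
  fix w assume "w \<in> Poly_Mapping.keys (u_degree_zero_part p x)"
  then have "p dvd u_degree w"
    by (auto simp: in_keys_iff lookup_u_degree_zero_part split: if_splits)
  moreover obtain gs where w: "w = Word gs" by (cases w)
  moreover obtain k where "k \<in> K" "cls (Poly_Mapping.single (Word gs) (Poly_Mapping.lookup (u_degree_zero_part p x) w)) = k \<otimes>\<^bsub>M\<^esub> z [^]\<^bsub>M\<^esub> u_degree (Word gs)"
    using word_in_K_times_z_power F by (metis (no_types, lifting) free_algebra_simps(1) mem_Collect_eq)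
  ultimately show "cls (Poly_Mapping.single w (Poly_Mapping.lookup (u_degree_zero_part p x) w)) \<in> K"
    using z_power_in_K subringE(6)[OF subring_K] by simp
qed

section \<open>Invariance of central idempotents under twists\<close>

lemma omega_power_C: "\<omega> ^ j \<in> C"
  by (rule C_power[OF omega(1)])

lemma twist_F: "c \<in> C \<Longrightarrow> x \<in> F \<Longrightarrow> twist c x \<in> F"
  by (auto simp: free_algebra_simps(1) lookup_twist intro: C_closed C_power)

lemma twist_I: "x \<in> I \<Longrightarrow> twist (\<omega> ^ j) x \<in> I"
proof (induction j arbitrary: x)
  case 0
  then show ?case by (simp add: twist_by_one)
next
  case (Suc j)
  have "I \<subseteq> {x \<in> F. twist \<omega> x \<in> I}"
    by (rule I_minimal)
       (use rels_carrier homogeneous in \<open>auto simp: twist_add twist_minus twist_mult twist_zero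
          intro: F_closed I_closed twist_F omega\<close>)
  with Suc.prems have "twist \<omega> x \<in> I" by blast
  from Suc.IH[OF this] show ?case by (simp add: twist_twist mult.commute)
qed

lemma torsion_free:
  assumes "c \<in> C" "c \<noteq> 0" "y \<in> carrier M" "c \<odot>\<^bsub>M\<^esub> y = \<zero>\<^bsub>M\<^esub>" shows "y = \<zero>\<^bsub>M\<^esub>"
proof (rule ccontr)
  assume "y \<noteq> \<zero>\<^bsub>M\<^esub>"
  then obtain \<phi> where \<phi>: "linear_form C M \<phi>" "\<phi> y \<noteq> 0" using faithful assms(3) by blast
  have "\<phi> (c \<odot>\<^bsub>M\<^esub> y) = c * \<phi> y" using \<phi>(1) assms(1,3) by (simp add: linear_form_def)
  then show False using \<phi>(2) assms(2,4) linear_form_zero[OF \<phi>(1)] by simp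
qed

text \<open>
  From \<open>g = cy\<close> and \<open>g = g\<^sup>2\<close> it follows that \<open>g\<close> is divisible by all powers of \<open>c\<close>, and so is its
  value under every linear form.
\<close>

lemma idempotent_adic_zero:
  assumes c: "c \<in> C" and sep: "\<And>r. r \<in> C \<Longrightarrow> (\<And>k. \<exists>y\<in>C. r = c ^ k * y) \<Longrightarrow> r = 0"
    and g: "g \<in> carrier M" "g \<otimes>\<^bsub>M\<^esub> g = g" and y: "y \<in> carrier M" "g = c \<odot>\<^bsub>M\<^esub> y"
  shows "g = \<zero>\<^bsub>M\<^esub>"
proof (rule ccontr)
  assume "g \<noteq> \<zero>\<^bsub>M\<^esub>"
  then obtain \<phi> where \<phi>: "linear_form C M \<phi>" "\<phi> g \<noteq> 0" using faithful g(1) by blast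
  have div: "\<exists>v\<in>carrier M. g = c ^ k \<odot>\<^bsub>M\<^esub> v" for k
  proof (induction k)
    case 0
    have "g = 1 \<odot>\<^bsub>M\<^esub> g" using g(1) C_closed(1) by (simp add: smult_conv_mult M_simps(3)[symmetric])
    then show ?case using g(1) by auto
  next
    case (Suc k)
    then obtain v where v: "v \<in> carrier M" "g = c ^ k \<odot>\<^bsub>M\<^esub> v" by blast
    note s = cls_closed[OF F_closed(7)[OF c]] cls_closed[OF F_closed(7)[OF C_power[OF c, of k]]]
    have "g = (c \<odot>\<^bsub>M\<^esub> y) \<otimes>\<^bsub>M\<^esub> (c ^ k \<odot>\<^bsub>M\<^esub> v)" using g(2) y(2) v(2) by simp
    also have "\<dots> = c \<odot>\<^bsub>M\<^esub> (c ^ k \<odot>\<^bsub>M\<^esub> (y \<otimes>\<^bsub>M\<^esub> v))"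
    proof -
      have "(cls (scalar c) \<otimes>\<^bsub>M\<^esub> y) \<otimes>\<^bsub>M\<^esub> (cls (scalar (c ^ k)) \<otimes>\<^bsub>M\<^esub> v) =
          cls (scalar c) \<otimes>\<^bsub>M\<^esub> ((y \<otimes>\<^bsub>M\<^esub> cls (scalar (c ^ k))) \<otimes>\<^bsub>M\<^esub> v)"
        using s y(1) v(1) by (simp add: M.m_assoc)
      also have "\<dots> = cls (scalar c) \<otimes>\<^bsub>M\<^esub> (cls (scalar (c ^ k)) \<otimes>\<^bsub>M\<^esub> (y \<otimes>\<^bsub>M\<^esub> v))"
        using s y(1) v(1) unfolding scalar_commute[OF C_power[OF c, of k] y(1), symmetric]
        by (simp add: M.m_assoc)
      finally show ?thesis using s y(1) v(1) c by (simp add: smult_conv_mult C_power)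
    qed
    also have "\<dots> = c ^ Suc k \<odot>\<^bsub>M\<^esub> (y \<otimes>\<^bsub>M\<^esub> v)"
      using c y(1) v(1) by (simp add: smult_smult C_power)
    finally show ?case using y(1) v(1) by blast
  qed
  have "\<exists>r\<in>C. \<phi> g = c ^ k * r" for k
    using div[of k] \<phi>(1) C_power[OF c, of k] by (auto simp: linear_form_def)
  then show False using sep[of "\<phi> g"] \<phi> g(1) by (auto simp: linear_form_def)
qed

text \<open>
  The coefficient of a word of degree \<open>n\<close> changes by the factor \<open>c\<^sup>n\<close>, and \<open>1 - c\<close> divides \<open>1 - c\<^sup>n\<close>.
\<close>

lemma twist_congruent:
  assumes c: "c \<in> C" and x: "x \<in> F"
  shows "\<exists>y\<in>F. x - twist c x = scalar (1 - c) * y"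
proof -
  define y where "y = Poly_Mapping.mapp (\<lambda>w a. (\<Sum>i<u_degree w. c ^ i) * a) x"
  have y: "Poly_Mapping.lookup y w = (\<Sum>i<u_degree w. c ^ i) * Poly_Mapping.lookup x w" for w
    by (simp add: y_def lookup_mapp when_def in_keys_iff)
  have "y \<in> F"
    using x C_power[OF c] subring_sum[OF subring_C, of _ "\<lambda>i. c ^ i"]
    by (auto simp: free_algebra_simps(1) y intro!: C_closed)
  moreover have "a - c ^ n * a = (1 - c) * ((\<Sum>i<n. c ^ i) * a)" for n a
    unfolding mult.assoc[symmetric] one_diff_power_eq[symmetric] by (simp add: left_diff_distrib)
  then have "x - twist c x = scalar (1 - c) * y"
    by (intro poly_mapping_eqI) (simp add: lookup_minus lookup_twist scalar_mult_lookup y)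
  ultimately show ?thesis by blast
qed

text \<open>
  Twisting by \<open>\<omega>\<^sup>j\<close> of prime power order changes an element by a multiple of \<open>1 - \<omega>\<^sup>j\<close>.  For a
  central idempotent \<open>e\<close> with twist \<open>e'\<close>, the idempotents \<open>e (1 - e')\<close> and \<open>e' (1 - e)\<close> are
  therefore divisible by all powers of \<open>1 - \<omega>\<^sup>j\<close>, hence zero, so that \<open>e = ee' = e'\<close>.
\<close>

lemma twist_fixes_central_idempotent_prime_power:
  assumes l: "prime l" "(\<omega> ^ j) ^ (l ^ a) = 1"
    and x: "x \<in> F" and idem: "cls x \<otimes>\<^bsub>M\<^esub> cls x = cls x" and central: "cls x \<in> ring_center M"
  shows "cls (twist (\<omega> ^ j) x) = cls x"
proof -
  define c where "c = \<omega> ^ j"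
  have c: "c \<in> C" by (simp add: c_def omega_power_C)
  define x' where "x' = twist c x"
  have x': "x' \<in> F" by (simp add: x'_def twist_F c x)
  have I: "x * x - x \<in> I" using idem x by (simp add: M_simps cls_eq_iff F_closed)
  then have "twist c (x * x - x) \<in> I" unfolding c_def by (rule twist_I)
  then have I': "x' * x' - x' \<in> I" by (simp add: x'_def twist_diff twist_mult)
  then have idem': "cls x' \<otimes>\<^bsub>M\<^esub> cls x' = cls x'" using x' by (simp add: M_simps cls_eq_iff F_closed)
  note xM = cls_closed[OF x] cls_closed[OF x']
  have comm: "cls x' \<otimes>\<^bsub>M\<^esub> cls x = cls x \<otimes>\<^bsub>M\<^esub> cls x'"
    using central xM by (auto simp: ring_center_def)
  obtain y where y: "y \<in> F" "x - x' = scalar (1 - c) * y"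
    using twist_congruent[OF c x] by (auto simp: x'_def)
  have c1: "1 - c \<in> C" using c by (simp add: C_closed)
  have compl: "\<one>\<^bsub>M\<^esub> \<ominus>\<^bsub>M\<^esub> cls v = cls (1 - v)" if "v \<in> F" for v
  proof -
    have "cls (1 - v) \<oplus>\<^bsub>M\<^esub> cls v = \<one>\<^bsub>M\<^esub>" using that by (simp add: M_simps F_closed)
    then show ?thesis using that by (metis M.minus_eq M.add.inv_solve_right cls_closed F_closed(1,6) M.one_closed)
  qed
  \<comment> \<open>To be applied to \<open>x\<close>, \<open>x'\<close> in both orders.\<close>
  have zero: "v * (1 - w) \<in> I"
    if vw: "v \<in> F" "w \<in> F" "v * v - v \<in> I" "w * w - w \<in> I" "v * w - w * v \<in> I"
      and y: "y \<in> F" "v - w = scalar (1 - c) * y" for v w y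
  proof -
    note F = F_closed(1-6) vw(1,2)
    have vi: "cls v \<otimes>\<^bsub>M\<^esub> cls v = cls v" and wi: "cls w \<otimes>\<^bsub>M\<^esub> cls w = cls w"
      using vw by (simp_all add: M_simps cls_eq_iff F_closed)
    have w1: "cls (1 - w) \<otimes>\<^bsub>M\<^esub> cls (1 - w) = cls (1 - w)"
      using M.idempotent_compl[OF cls_closed[OF vw(2)] wi] compl[OF vw(2)] by simp
    have "v * (1 - w) - (1 - w) * v \<in> I" using I_closed(2)[OF vw(5)] by (simp add: algebra_simps)
    then have cm1: "cls v \<otimes>\<^bsub>M\<^esub> cls (1 - w) = cls (1 - w) \<otimes>\<^bsub>M\<^esub> cls v"
      using F by (simp add: M_simps cls_eq_iff)
    let ?g = "cls v \<otimes>\<^bsub>M\<^esub> cls (1 - w)"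
    have g: "?g \<otimes>\<^bsub>M\<^esub> ?g = ?g"
      by (rule M.idempotent_mult) (use F vi w1 cm1 in \<open>auto intro: cls_closed\<close>)
    have "v * (1 - w) - scalar (1 - c) * (v * y) = - (v * v - v) + (v * (v - w) - scalar (1 - c) * (v * y))"
      by (simp add: algebra_simps)
    also have "v * (v - w) = scalar (1 - c) * (v * y)"
      unfolding y(2) by (metis mult.assoc scalar_central)
    finally have "v * (1 - w) - scalar (1 - c) * (v * y) \<in> I" using I_closed(2)[OF vw(3)] by simp
    then have "?g = (1 - c) \<odot>\<^bsub>M\<^esub> cls (v * y)"
      using F y(1) c1 by (simp add: M_simps F_closed cls_eq_iff)
    then have "?g = \<zero>\<^bsub>M\<^esub>"
      using separated[OF l] g F y(1)
      by (intro idempotent_adic_zero[OF c1, of ?g "cls (v * y)"] M.m_closed cls_closed F_closed)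
         (simp_all add: c_def)
    then show ?thesis using F by (simp add: M_simps(2) cls_eq_zero_iff)
  qed
  have cI: "x * x' - x' * x \<in> I" using comm[symmetric] x x' by (simp add: M_simps cls_eq_iff F_closed)
  have "x * (1 - x') \<in> I" by (rule zero[OF x x' I I' cI y])
  moreover have "x' * (1 - x) \<in> I"
  proof (rule zero[OF x' x I' I])
    show "x' * x - x * x' \<in> I" using I_closed(2)[OF cI] by simp
    show "- y \<in> F" using y(1) by (rule F_closed)
    show "x' - x = scalar (1 - c) * - y" unfolding mult_minus_right y(2)[symmetric] by simp
  qed
  ultimately have "x' * (1 - x) - x * (1 - x') - (x * x' - x' * x) \<in> I" by (intro I_closed(4)[OF I_closed(4) cI])
  then have "x' - x \<in> I" by (simp add: algebra_simps)
  then show ?thesis using x x' by (simp add: cls_eq_iff x'_def c_def)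
qed

text \<open>
  The exponents \<open>j\<close> for which the twist by \<open>\<omega>\<^sup>j\<close> fixes \<open>e\<close> are the multiples of some \<open>D\<close>.  They include
  \<open>p\<close> and, for every prime \<open>l\<close>, the largest divisor of \<open>p\<close> prime to \<open>l\<close>; hence no prime divides \<open>D\<close>.
\<close>

lemma twist_fixes_central_idempotent:
  assumes x: "x \<in> F" and idem: "cls x \<otimes>\<^bsub>M\<^esub> cls x = cls x" and central: "cls x \<in> ring_center M"
  shows "cls (twist (\<omega> ^ j) x) = cls x"
proof -
  define J where "J = {j. x - twist (\<omega> ^ j) x \<in> I}"
  have tF: "twist (\<omega> ^ j) x \<in> F" for j by (rule twist_F[OF omega_power_C x])
  have J_iff: "j \<in> J \<longleftrightarrow> cls (twist (\<omega> ^ j) x) = cls x" for j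
    using cls_eq_iff[OF x tF, of j] by (auto simp: J_def)
  have J_add_iff: "i + k \<in> J \<longleftrightarrow> k \<in> J" if "i \<in> J" for i k
  proof -
    have "twist (\<omega> ^ k) (x - twist (\<omega> ^ i) x) \<in> I" using that twist_I by (simp add: J_def)
    then have *: "twist (\<omega> ^ k) x - twist (\<omega> ^ (i + k)) x \<in> I"
      by (simp add: twist_diff twist_twist power_add mult.commute)
    show ?thesis
      using I_closed(3)[OF _ *, of "x - twist (\<omega> ^ k) x"] I_closed(4)[OF _ *, of "x - twist (\<omega> ^ (i + k)) x"]
      by (auto simp: J_def)
  qed
  have J0: "0 \<in> J" by (simp add: J_def twist_by_one I_closed)
  have J_mult: "i * k \<in> J" if "i \<in> J" for i k
    by (induction k) (use J0 J_add_iff[OF that] in auto)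
  have J_gcd: "gcd i k \<in> J" if ik: "i \<in> J" "k \<in> J" "i \<noteq> 0" for i k
  proof -
    obtain a b where "i * a = k * b + gcd i k" using bezout_nat[OF ik(3)] by blast
    then show ?thesis using J_add_iff[OF J_mult[OF ik(2)], of b "gcd i k"] J_mult[OF ik(1), of a] by simp
  qed
  have pJ: "p \<in> J" using omega(2) by (simp add: J_def twist_by_one I_closed)
  define D where "D = (LEAST j. j > 0 \<and> j \<in> J)"
  have D: "D > 0" "D \<in> J" using LeastI[of "\<lambda>j. j > 0 \<and> j \<in> J" p] p pJ by (auto simp: D_def)
  have D_dvd: "D dvd i" if "i \<in> J" for i
  proof -
    have "gcd D i \<in> J" "gcd D i > 0" using J_gcd[OF D(2) that] D(1) by auto
    then have "D \<le> gcd D i" unfolding D_def by (intro Least_le) simp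
    then show ?thesis using D(1) by (metis dvd_imp_le gcd_dvd1 gcd_dvd2 le_antisym)
  qed
  have "D = 1"
  proof (rule ccontr)
    assume "D \<noteq> 1"
    then obtain l where l: "prime l" "l dvd D" using prime_factor_nat by blast
    obtain m where m: "p = l ^ multiplicity l p * m" "\<not> l dvd m"
      using multiplicity_decompose'[of p l] p(1) l(1) by (metis not_prime_unit not_one_le_zero)
    have "(\<omega> ^ m) ^ (l ^ multiplicity l p) = 1"
      using omega(2) m(1) by (metis power_mult mult.commute)
    from twist_fixes_central_idempotent_prime_power[OF l(1) this x idem central]
    have "m \<in> J" by (simp only: J_iff)
    then have "D dvd m" by (rule D_dvd)
    with l(2) m(2) show False by (metis dvd_trans)
  qed
  then have "j \<in> J" using J_mult[OF D(2), of j] by simp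
  then show ?thesis by (simp only: J_iff)
qed

text \<open>
  An element fixed by all twists agrees, after multiplication by \<open>p\<close>, with its part of degree
  zero; there is no \<open>p\<close>-torsion.
\<close>

lemma central_idempotent_in_K:
  assumes idem: "e \<otimes>\<^bsub>M\<^esub> e = e" and central: "e \<in> ring_center M"
  shows "e \<in> K"
proof -
  obtain x where x: "x \<in> F" "e = cls x" using central by (auto simp: ring_center_def carrier_M)
  let ?x0 = "u_degree_zero_part p x"
  have x0: "?x0 \<in> F"
    using x(1) C_closed(2) by (simp add: free_algebra_simps(1) lookup_u_degree_zero_part)
  have "x - twist (\<omega> ^ j) x \<in> I" for j
    using twist_fixes_central_idempotent[OF x(1), of j] idem central
      cls_eq_iff[OF x(1) twist_F[OF omega_power_C x(1)], of j] by (simp add: x(2))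
  then have "(\<Sum>j<p. x - twist (\<omega> ^ j) x) \<in> I" by (intro I_sum)
  moreover have "of_nat p \<in> C" using C_closed by (induction p) auto
  moreover have "(\<Sum>j<p. x - twist (\<omega> ^ j) x) = scalar (of_nat p) * (x - ?x0)"
  proof -
    have "(\<Sum>j<p. x) = scalar (of_nat p) * x"
      by (rule poly_mapping_eqI, subst lookup_sum) (simp add: scalar_mult_lookup)
    then show ?thesis using sum_twist[OF omega(2,3), of x]
      by (simp only: sum_subtractf right_diff_distrib)
  qed
  ultimately have "of_nat p \<odot>\<^bsub>M\<^esub> cls (x - ?x0) = \<zero>\<^bsub>M\<^esub>"
    using x(1) x0 by (simp add: M_simps(5) F_closed cls_eq_zero_iff)
  then have "cls (x - ?x0) = \<zero>\<^bsub>M\<^esub>"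
    by (rule torsion_free[OF \<open>of_nat p \<in> C\<close> p(2) cls_closed[OF F_closed(6)[OF x(1) x0]]])
  then have "cls x = cls ?x0" using x(1) x0 by (simp add: cls_eq_zero_iff cls_eq_iff F_closed)
  then show ?thesis using u_degree_zero_in_K[OF x(1)] x(2) by simp
qed

lemma block_idempotents_K:
  "block_idempotents (generated_subalgebra C M {s, t, u [^]\<^bsub>M\<^esub> p}) = block_idempotents M"
  unfolding generated_subalgebra_def K_def[symmetric]
proof (rule block_idempotents_cong)
  fix e assume idem: "e \<otimes>\<^bsub>M\<^esub> e = e"
  show "e \<in> ring_center (M\<lparr>carrier := K\<rparr>) \<longleftrightarrow> e \<in> ring_center M"
    using center_K_subset central_idempotent_in_K[OF idem] K_carrier by (auto simp: ring_center_def)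
qed

end

section \<open>The Hecke algebras\<close>

lemma zeta_power_eq_one_imp_dvd:
  assumes n: "n \<ge> 1" and k: "zeta n ^ k = 1"
  shows "n dvd k"
proof -
  have z: "zeta n ^ m = cis (2 * pi * real m / real n)" for m
  proof -
    have "zeta n = cis (2 * pi / real n)" by (simp add: zeta_def cis_conv_exp mult_ac)
    then show ?thesis by (simp add: DeMoivre mult_ac)
  qed
  have "zeta n ^ k = zeta n ^ (n * (k div n) + k mod n)" by simp
  also have "\<dots> = zeta n ^ (k mod n)"
    by (simp only: power_add power_mult zeta_power[OF n] power_one mult_1)
  finally have "zeta n ^ (k mod n) = 1" using k by simp
  then have "cis (2 * pi * real (k mod n) / real n) = cis (2 * pi * real 0 / real n)"
    unfolding z by simp
  moreover have "inj_on (\<lambda>k. cis (2 * pi * real k / real n)) {..<n}"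
    using bij_betw_roots_unity[of n] n by (auto simp: bij_betw_def)
  ultimately have "k mod n = 0" using n by (elim inj_onD) simp_all
  then show ?thesis by (simp only: dvd_eq_mod_eq_0)
qed

lemma prod_list_map_commute:
  fixes g :: "'b \<Rightarrow> 'a::monoid_mult"
  assumes "\<And>i j. g i * g j = g j * g i"
  shows "prod_list (map g xs) * prod_list (map g ys) = prod_list (map g ys) * prod_list (map g xs)"
proof -
  have 1: "g i * prod_list (map g zs) = prod_list (map g zs) * g i" for i zs
  proof (induction zs)
    case (Cons a zs)
    have "g i * prod_list (map g (a # zs)) = (g i * g a) * prod_list (map g zs)"
      by (simp add: mult.assoc)
    also have "\<dots> = g a * (g i * prod_list (map g zs))" by (simp only: assms[of i a] mult.assoc)
    finally show ?case by (simp add: Cons.IH mult.assoc)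
  qed simp
  show ?thesis
  proof (induction xs)
    case (Cons a xs)
    have "prod_list (map g (a # xs)) * prod_list (map g ys) = g a * (prod_list (map g ys) * prod_list (map g xs))"
      by (simp add: Cons.IH mult.assoc)
    also have "\<dots> = (g a * prod_list (map g ys)) * prod_list (map g xs)" by (simp only: mult.assoc)
    finally show ?case by (simp only: 1 list.simps(9) prod_list.Cons mult.assoc)
  qed simp
qed

text \<open>
  The twist by \<open>\<zeta>\<^sub>p\<^sup>-\<^sup>1\<close> permutes the factors of the relator of \<open>u\<close> cyclically up to a scalar,
  because the parameters satisfy \<open>\<zeta>\<^sub>p \<mu>\<^sub>k = \<mu>\<^sub>k\<^sub>+\<^sub>d\<close>.
\<close>

lemma twist_u_relator:
  fixes \<mu> :: "nat \<Rightarrow> 'k::field" and p d :: nat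
  defines "g \<equiv> \<lambda>k. letter u_gen - scalar (\<mu> k) :: gen word \<Rightarrow>\<^sub>0 'k"
  assumes p: "p \<ge> 1" and shift: "\<And>k. \<omega> * \<mu> (k + d) = \<mu> k" and period: "\<And>k. \<mu> (k + p * d) = \<mu> k"
  shows "twist \<omega> (prod_list (map g [0..<p * d])) = scalar (\<omega> ^ (p * d)) * prod_list (map g [0..<p * d])"
proof -
  have tg: "twist \<omega> (g k) = scalar \<omega> * g (k + d)" for k
    by (simp add: g_def twist_diff twist_letter twist_scalar right_diff_distrib shift flip: scalar_mult)
  have "twist \<omega> (prod_list (map g ks)) = scalar (\<omega> ^ length ks) * prod_list (map (\<lambda>k. g (k + d)) ks)" for ks
  proof (induction ks)
    case Nil
    show ?case by (simp add: twist_one)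
  next
    case (Cons k ks)
    have "twist \<omega> (prod_list (map g (k # ks))) =
        scalar \<omega> * (g (k + d) * scalar (\<omega> ^ length ks)) * prod_list (map (\<lambda>k. g (k + d)) ks)"
      by (simp add: twist_mult tg Cons.IH mult.assoc)
    then show ?case
      by (simp add: scalar_mult mult.assoc flip: scalar_central[of _ "g (k + d)"])
  qed
  from this[of "[0..<p * d]"]
  have "twist \<omega> (prod_list (map g [0..<p * d])) =
      scalar (\<omega> ^ (p * d)) * prod_list (map (\<lambda>k. g (k + d)) [0..<p * d])" by simp
  also have "map (\<lambda>k. g (k + d)) [0..<p * d] = map g [d..<p * d + d]"
    by (rule nth_equalityI) (simp_all add: add.commute)
  also have "[d..<p * d + d] = [d..<p * d] @ [p * d..<p * d + d]"
    using p by (intro upt_add_eq_append) simp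
  also have "map g ([d..<p * d] @ [p * d..<p * d + d]) = map g [d..<p * d] @ map g [0..<d]"
  proof -
    have "map g [p * d..<p * d + d] = map g [0..<d]"
      by (rule nth_equalityI) (simp_all add: g_def period add.commute[of "p * d"])
    then show ?thesis by simp
  qed
  also have "prod_list (map g [d..<p * d] @ map g [0..<d]) = prod_list (map g [0..<d]) * prod_list (map g [d..<p * d])"
    unfolding prod_list.append
  proof (rule prod_list_map_commute)
    fix i j
    show "g i * g j = g j * g i"
      using scalar_central[of "\<mu> i" "letter u_gen"] scalar_central[of "\<mu> j" "letter u_gen"]
        scalar_central[of "\<mu> i" "scalar (\<mu> j)"]
      by (simp add: g_def left_diff_distrib right_diff_distrib)
  qed
  also have "\<dots> = prod_list (map g [0..<p * d])"
  proof -
    have "[0..<p * d] = [0..<d] @ [d..<p * d]"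
      using p upt_add_eq_append[of 0 d "p * d - d"] by simp
    then show ?thesis by simp
  qed
  finally show ?thesis .
qed

theorem proposition4p10:
  fixes p d :: nat and a0 a1 b0 b1 :: int and c :: "nat \<Rightarrow> int"
  defines "A \<equiv> laurent_ring (2 * p * d)" and "R \<equiv> rouquier_ring (2 * p * d)"
  assumes "p \<ge> 1" and "d \<ge> 1"
    and "free_of_rank A (hecke A p d a0 a1 b0 b1 c) ((2 * p * d)\<^sup>2)"
    and "free_of_rank A (hecke_bar A p d a0 a1 b0 b1 c) ((2 * p * d)\<^sup>2 div p)"
    and "\<exists>\<tau>. canonical_symmetrizing_form A (2 * p * d) 1
               (hecke A p d a0 a1 b0 b1 c) (hecke_gen A p d a0 a1 b0 b1 c) \<tau>"
    and "\<exists>\<tau>. canonical_symmetrizing_form A (2 * p * d) p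
               (hecke_bar A p d a0 a1 b0 b1 c) (hecke_gen A p d a0 a1 b0 b1 c) \<tau>"
  shows "block_idempotents (hecke_bar R p d a0 a1 b0 b1 c) =
         block_idempotents (hecke R p d a0 a1 b0 b1 c)"
proof -
  note [simp del] = free_algebra_simps(1)
  define rels where "rels = hecke_relators p d a0 a1 b0 b1 c"
  have loc: "is_localization A R" unfolding A_def R_def by (rule laurent_rouquier_localization)
  have AR: "A \<subseteq> R" using loc by (simp add: is_localization_def)
  have relsA: "rels \<subseteq> carrier (free_algebra A)"
    unfolding rels_def A_def by (rule hecke_relators_carrier[OF assms(3,4)])
  have R: "subring R ring_of_type_algebra" unfolding R_def by (rule rouquier_subring)
  interpret pr: presentation R rels
    by (rule presentation.intro[OF R]) (use relsA AR in \<open>auto simp: free_algebra_simps(1)\<close>)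
  have free: "free_of_rank A (presented_algebra A rels) ((2 * p * d)\<^sup>2)"
    using assms(5) by (simp add: hecke_def rels_def)
  have Rgen: "x \<in> R" if "x \<in> const ` cyclotomic_integers (2 * p * d) \<union> {q, inverse q}" for x
    unfolding R_def rouquier_ring_def by (rule generate_ring.incl) (use that in blast)
  have Rpow: "x ^ i \<in> R" if "x \<in> R" for x i using that pr.C_closed by (induction i) auto
  have qR: "q powi k \<in> R" "inverse (q powi k) \<in> R" for k
  proof -
    have "q powi k \<in> R" for k using Rpow Rgen by (simp add: power_int_def)
    from this[of k] this[of "- k"] show "q powi k \<in> R" "inverse (q powi k) \<in> R"
      by (simp_all add: power_int_minus)
  qed
  have zR: "const (zeta (p * d) ^ k) \<in> R" for k
    using Rgen zeta_power_integer[OF assms(3,4)] by blast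
  have pd: "p * d \<ge> 1" using assms(3,4) by simp
  \<comment> \<open>This is \<open>\<zeta>\<^sub>p\<^sup>-\<^sup>1\<close>, written as a nonnegative power of \<open>\<zeta>\<^sub>p\<^sub>d\<close>, so that it visibly lies in \<open>\<R>\<^sub>K(q)\<close>.\<close>
  define \<zeta> where "\<zeta> = zeta (p * d) ^ (d * (p - 1))"
  define \<omega> where "\<omega> = const \<zeta>"
  have \<zeta>_inverse: "\<zeta> * zeta (p * d) ^ d = 1"
  proof -
    have "d * (p - 1) + d = p * d" using assms(3) by (cases p) (simp_all add: algebra_simps)
    then show ?thesis using zeta_power[OF pd] by (simp add: \<zeta>_def flip: power_add)
  qed
  have \<omega>_power: "\<omega> ^ j = const (\<zeta> ^ j)" for j by (simp add: \<omega>_def const_power)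
  define \<mu> where "\<mu> k = const (zeta (p * d) ^ k) * q powi c (k mod d)" for k
  have shift: "\<omega> * \<mu> (k + d) = \<mu> k" for k
  proof -
    have "\<omega> * \<mu> (k + d) = const ((\<zeta> * zeta (p * d) ^ d) * zeta (p * d) ^ k) * q powi c (k mod d)"
      by (simp add: \<omega>_def \<mu>_def power_add const_mult mult_ac)
    then show ?thesis by (simp add: \<zeta>_inverse \<mu>_def)
  qed
  have period: "\<mu> (k + p * d) = \<mu> k" for k
    using zeta_power[OF pd] by (simp add: \<mu>_def power_add)
  have \<omega>R: "\<omega> \<in> R" unfolding \<omega>_def \<zeta>_def by (rule zR)
  interpret braid_presentation R rels p "q powi (int p * a0)" "q powi (int p * a1)"
    "q powi (int p * b0)" "q powi (int p * b1)" \<omega>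
  proof (unfold_locales, goal_cases)
    case 1
    show ?case by (rule assms(3))
  next
    case 2
    have "of_nat n = const (of_nat n)" for n by (induction n) (simp_all add: const_zero const_add const_one)
    then show ?case using assms(3) by (simp add: const_eq_zero_iff)
  next
    case 19
    show ?case by (rule \<omega>R)
  next
    case 20
    have "\<zeta> ^ p = zeta (p * d) ^ (p * d * (p - 1))" unfolding \<zeta>_def power_mult[symmetric] by (simp only: mult_ac)
    also have "\<dots> = 1" unfolding power_mult[of _ "p * d"] zeta_power[OF pd] by simp
    finally show ?case by (simp add: \<omega>_power const_one)
  next
    case (21 j)
    have "const (\<zeta> ^ j) = const 1" using 21 by (simp add: \<omega>_power const_one)
    then have "\<zeta> ^ j = 1" by (simp add: const_def eq_fract)
    \<comment> \<open>Passing from \<open>\<zeta>\<close> to its inverse turns the exponent \<open>d (p - 1)\<close> into \<open>d\<close>.\<close>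
    have "zeta (p * d) ^ (d * j) = (\<zeta> * zeta (p * d) ^ d) ^ j"
      unfolding power_mult_distrib \<open>\<zeta> ^ j = 1\<close> by (simp add: power_mult)
    then have "zeta (p * d) ^ (d * j) = 1" by (simp add: \<zeta>_inverse)
    then have "p * d dvd d * j" by (rule zeta_power_eq_one_imp_dvd[OF pd])
    then show ?case using assms(4) by (simp add: mult.commute)
  next
    case (22 r)
    \<comment> \<open>Every relator is an eigenvector of the twist.\<close>
    have "twist \<omega> r = r \<or> (\<exists>m. twist \<omega> r = scalar (\<omega> ^ m) * r)"
    proof -
      let ?s = "letter s_gen :: gen word \<Rightarrow>\<^sub>0 complex poly fract"
      let ?t = "letter t_gen :: gen word \<Rightarrow>\<^sub>0 complex poly fract"
      let ?u = "letter u_gen :: gen word \<Rightarrow>\<^sub>0 complex poly fract"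
      have s: "twist \<omega> ?s = ?s" and t: "twist \<omega> ?t = ?t" and u: "twist \<omega> ?u = scalar \<omega> * ?u"
        by (simp_all add: twist_letter)
      have lc: "x * (scalar \<omega> * y) = scalar \<omega> * (x * y)" for x y :: "gen word \<Rightarrow>\<^sub>0 complex poly fract"
        using scalar_central[of \<omega> x] by (simp flip: mult.assoc)
      consider "r = ?s * ?t * ?u - ?t * ?u * ?s" | "r = ?t * ?u * ?s - ?u * ?s * ?t"
        | a b where "r = (?s - scalar a) * (?s + scalar b)" | a b where "r = (?t - scalar a) * (?t + scalar b)"
        | "r = prod_list (map (\<lambda>k. ?u - scalar (\<mu> k)) [0..<p * d])"
        using 22 by (auto simp: rels_def hecke_relators_def Let_def \<mu>_def)
      then show ?thesis
      proof cases
        case 1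
        have "twist \<omega> r = scalar (\<omega> ^ 1) * r"
          unfolding 1 twist_diff twist_mult s t u
          by (simp add: right_diff_distrib mult.assoc lc)
        then show ?thesis by blast
      next
        case 2
        have "twist \<omega> r = scalar (\<omega> ^ 1) * r"
          unfolding 2 twist_diff twist_mult s t u
          by (simp add: right_diff_distrib mult.assoc lc)
        then show ?thesis by blast
      next
        case 5
        then show ?thesis
          using twist_u_relator[OF assms(3), of \<omega> \<mu> d] shift period by blast
      qed (simp_all add: twist_mult twist_diff twist_add twist_scalar s t)
    qed
    moreover have "r \<in> pr.I" using 22 pr.rels_I by blast
    ultimately show ?case
      using pr.I_closed(6)[OF \<open>r \<in> pr.I\<close> pr.F_closed(7)[OF Rpow[OF \<omega>R]]] by auto
  next
    case (23 y)
    show ?case by (rule localized_separating_linear_form[OF loc relsA free 23])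
  next
    case (24 l a j r)
    have "(\<zeta> ^ j) ^ (l ^ a) = 1"
    proof -
      have "const ((\<zeta> ^ j) ^ (l ^ a)) = const 1" using 24(2) by (simp add: \<omega>_power const_one const_power)
      then show ?thesis by (simp add: const_def eq_fract)
    qed
    moreover have "const (1 - \<zeta> ^ j) = 1 - \<omega> ^ j" by (simp add: const_diff const_one \<omega>_power)
    ultimately show ?case
      using rouquier_ring_separated[OF 24(1), of "\<zeta> ^ j" a r "2 * p * d"] 24(3,4) by (simp add: R_def)
  qed (simp_all add: rels_def hecke_relators_def Let_def q_nonzero qR)
  show ?thesis
    using block_idempotents_K unfolding pr.cls_def
    by (simp add: hecke_bar_def hecke_def hecke_gen_def presented_gen_def rels_def Let_def)
qed

end
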